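(* Let $\mathsf{C}$ be a strict monoidal category. Then $\mathsf{L}(\mathsf{C}^{\mathrm{op}})^{\mathrm{op}}$ is an oplax morphism classifier for $\mathsf{C}$; that is, for any strict monoidal category $\mathsf{D}$ there is an isomorphism of categories $$\mathbf{Oplax}(\mathsf{C},\mathsf{D})\cong\mathbf{Strict}(\mathsf{L}(\mathsf{C}^{\mathrm{op}})^{\mathrm{op}},\mathsf{D}),$$ where $\mathsf{L}(-)$ is the construction by generators and relations described in the context.
   Context: For a strict monoidal category $\mathsf{C}$, $\mathsf{C}^{\mathrm{op}}$ denotes the opposite category (morphisms reversed) with the same tensor product on objects and morphisms and the same unit; it is again strict monoidal. **The category $\mathsf{L}(\mathsf{C})$.** For a strict monoidal category $\mathsf{C}$ with tensor product $\otimes$ and unit $\mathbb{1}$, $\mathsf{L}(\mathsf{C})$ is the strict monoidal category presented as follows. Its monoid of objects is the free monoid on the set of symbols $\{\underline{x} \mid x\in \mathrm{Obj}\,\mathsf{C}\}$, i.e. finite lists of symbols $\underline{x}$, with tensor product given by concatenation and monoidal unit the empty list $\emptyset$. Its morphisms are generated, as a strict monoidal category (under composition and tensor product), by: a morphism $\underline{f}:\underline{x}\to\underline{y}$ for every $x,y\in\mathrm{Obj}\,\mathsf{C}$ and $f\in \mathrm{Hom}_{\mathsf{C}}(x,y)$; a morphism $\ell_{x,z}:\underline{x}\otimes\underline{z}\to\underline{x\otimes z}$ for all $x,z\in \mathrm{Obj}\,\mathsf{C}$; and a morphism $j:\emptyset\to\underline{\mathbb{1}}$. They are subject to the relations (for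 all objects and all suitable morphisms of $\mathsf{C}$): (0) $\underline{\mathrm{id}_x}=\mathrm{id}_{\underline{x}}$; (1) $\underline{g}\circ\underline{f}=\underline{g\circ f}$ for composable $f,g$; (2) $\ell_{y,y'}\circ(\underline{f}\otimes\underline{f'})=\underline{f\otimes f'}\circ\ell_{x,x'}$ for $f:x\to y$, $f':x'\to y'$; (3) $\ell_{x\otimes z,w}\circ(\ell_{x,z}\otimes\mathrm{id}_{\underline{w}})=\ell_{x,z\otimes w}\circ(\mathrm{id}_{\underline{x}}\otimes\ell_{z,w})$; (4) $\ell_{x,\mathbb{1}}\circ(\mathrm{id}_{\underline{x}}\otimes j)=\mathrm{id}_{\underline{x}}$; (5) $\ell_{\mathbb{1},x}\circ(j\otimes\mathrm{id}_{\underline{x}})=\mathrm{id}_{\underline{x}}$. **Oplax monoidal functors.** An oplax monoidal functor $\mathcal{F}:\mathsf{C}\to\mathsf{D}$ between strict monoidal categories is a functor together with morphisms $c_{X,Y}:\mathcal{F}(X\otimes Y)\to\mathcal{F}(X)\otimes\mathcal{F}(Y)$ and $e:\mathcal{F}(\mathbb{1}_{\mathsf{C}})\to\mathbb{1}_{\mathsf{D}}$ making $\mathcal{F}^{\mathrm{op}}:\mathsf{C}^{\mathrm{op}}\to\mathsf{D}^{\mathrm{op}}$ a lax monoidal functor; explicitly, $c_{X,Y}$ is natural in $X,Y$, $(c_{X,Y}\otimes\mathrm{id}_{\mathcal{F}(Z)})\circ c_{X\otimes Y,Z}=(\mathrm{id}_{\mathcal{F}(X)}\otimes c_{Y,Z})\circ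 c_{X,Y\otimes Z}$, $(e\otimes\mathrm{id}_{\mathcal{F}(X)})\circ c_{\mathbb{1},X}=\mathrm{id}_{\mathcal{F}(X)}$ and $(\mathrm{id}_{\mathcal{F}(X)}\otimes e)\circ c_{X,\mathbb{1}}=\mathrm{id}_{\mathcal{F}(X)}$. It is strict if all $c_{X,Y}$ and $e$ are identities. **Functor categories.** $\mathbf{Oplax}(\mathsf{C},\mathsf{D})$ has as objects the oplax monoidal functors $\mathsf{C}\to\mathsf{D}$ and as morphisms the natural transformations $\sigma:\mathcal{F}\Rightarrow\mathcal{G}$ with $c^{\mathcal{G}}_{X,Y}\circ\sigma_{X\otimes Y}=(\sigma_X\otimes\sigma_Y)\circ c^{\mathcal{F}}_{X,Y}$ for all $X,Y$ and $e^{\mathcal{G}}\circ\sigma_{\mathbb{1}}=e^{\mathcal{F}}$. $\mathbf{Strict}(\mathsf{C},\mathsf{D})$ has as objects the strict monoidal functors and as morphisms the monoidal transformations, i.e. natural transformations $\sigma$ with $\sigma_{X\otimes Y}=\sigma_X\otimes\sigma_Y$ and $\sigma_{\mathbb{1}}=\mathrm{id}$. *)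

theory Defs
  imports "HOL-Library.FuncSet"
begin

section \<open>Strict monoidal categories\<close>

text \<open>Categories are records with explicit carriers; the operations are only constrained on the
  carriers.  \<open>Comp C g f\<close> is the composite of \<open>f\<close> followed by \<open>g\<close>.\<close>

record ('o, 'a) cat =
  Obj :: "'o set"
  Arr :: "'a set"
  Dom :: "'a \<Rightarrow> 'o"
  Cod :: "'a \<Rightarrow> 'o"
  Ident :: "'o \<Rightarrow> 'a"
  Comp :: "'a \<Rightarrow> 'a \<Rightarrow> 'a"

record ('o, 'a) smcat = "('o, 'a) cat" +
  Unit :: 'o
  TenO :: "'o \<Rightarrow> 'o \<Rightarrow> 'o"
  TenA :: "'a \<Rightarrow> 'a \<Rightarrow> 'a"

definition Hom :: "('o, 'a, 'e) cat_scheme \<Rightarrow> 'o \<Rightarrow> 'o \<Rightarrow> 'a set" where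
  "Hom C x y = {f \<in> Arr C. Dom C f = x \<and> Cod C f = y}"

locale category =
  fixes C :: "('o, 'a, 'e) cat_scheme"
  assumes Dom_Obj: "f \<in> Arr C \<Longrightarrow> Dom C f \<in> Obj C"
    and Cod_Obj: "f \<in> Arr C \<Longrightarrow> Cod C f \<in> Obj C"
    and Ident_Hom: "x \<in> Obj C \<Longrightarrow> Ident C x \<in> Hom C x x"
    and Comp_Hom: "\<lbrakk>f \<in> Hom C x y; g \<in> Hom C y z\<rbrakk> \<Longrightarrow> Comp C g f \<in> Hom C x z"
    and Comp_Ident: "f \<in> Hom C x y \<Longrightarrow> Comp C f (Ident C x) = f"
    and Ident_Comp: "f \<in> Hom C x y \<Longrightarrow> Comp C (Ident C y) f = f"
    and Comp_assoc: "\<lbrakk>f \<in> Hom C w x; g \<in> Hom C x y; h \<in> Hom C y z\<rbrakk>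
      \<Longrightarrow> Comp C h (Comp C g f) = Comp C (Comp C h g) f"

locale strict_monoidal_category = category C
  for C :: "('o, 'a, 'e) smcat_scheme" +
  assumes Unit_Obj: "Unit C \<in> Obj C"
    and TenO_Obj: "\<lbrakk>x \<in> Obj C; y \<in> Obj C\<rbrakk> \<Longrightarrow> TenO C x y \<in> Obj C"
    and TenO_assoc: "\<lbrakk>x \<in> Obj C; y \<in> Obj C; z \<in> Obj C\<rbrakk>
      \<Longrightarrow> TenO C (TenO C x y) z = TenO C x (TenO C y z)"
    and TenO_Unit_left: "x \<in> Obj C \<Longrightarrow> TenO C (Unit C) x = x"
    and TenO_Unit_right: "x \<in> Obj C \<Longrightarrow> TenO C x (Unit C) = x"
    and TenA_Hom: "\<lbrakk>f \<in> Hom C x y; f' \<in> Hom C x' y'\<rbrakk>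
      \<Longrightarrow> TenA C f f' \<in> Hom C (TenO C x x') (TenO C y y')"
    and TenA_assoc: "\<lbrakk>f \<in> Arr C; g \<in> Arr C; h \<in> Arr C\<rbrakk>
      \<Longrightarrow> TenA C (TenA C f g) h = TenA C f (TenA C g h)"
    and TenA_Unit_left: "f \<in> Arr C \<Longrightarrow> TenA C (Ident C (Unit C)) f = f"
    and TenA_Unit_right: "f \<in> Arr C \<Longrightarrow> TenA C f (Ident C (Unit C)) = f"
    and TenA_Ident: "\<lbrakk>x \<in> Obj C; y \<in> Obj C\<rbrakk>
      \<Longrightarrow> TenA C (Ident C x) (Ident C y) = Ident C (TenO C x y)"
    and interchange: "\<lbrakk>f \<in> Hom C x y; g \<in> Hom C y z; f' \<in> Hom C x' y'; g' \<in> Hom C y' z'\<rbrakk>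
      \<Longrightarrow> TenA C (Comp C g f) (Comp C g' f') = Comp C (TenA C g g') (TenA C f f')"

definition opp :: "('o, 'a, 'e) cat_scheme \<Rightarrow> ('o, 'a, 'e) cat_scheme" where
  "opp C = C\<lparr>Dom := Cod C, Cod := Dom C, Comp := (\<lambda>g f. Comp C f g)\<rparr>"

section \<open>The strict monoidal category \<open>L(C)\<close>\<close>

text \<open>Objects are lists of objects of \<open>C\<close>, the letter \<open>x\<close> standing for the symbol
  indexed by \<open>x\<close>.  Arrows are formal expressions in the generators \<open>TArr f\<close>, \<open>TMult x z\<close> (for
  \<open>\<ell>\<close>) and \<open>TUnit\<close> (for \<open>j\<close>), modulo the congruence generated by the axioms of a strict
  monoidal category and the six defining relations.\<close>

datatype ('o, 'a) lterm =
    TArr 'a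
  | TMult 'o 'o
  | TUnit
  | TId "'o list"
  | TComp "('o, 'a) lterm" "('o, 'a) lterm"
  | TTen "('o, 'a) lterm" "('o, 'a) lterm"

primrec tdom :: "('o, 'a, 'e) smcat_scheme \<Rightarrow> ('o, 'a) lterm \<Rightarrow> 'o list" where
  "tdom C (TArr f) = [Dom C f]"
| "tdom C (TMult x z) = [x, z]"
| "tdom C TUnit = []"
| "tdom C (TId xs) = xs"
| "tdom C (TComp t s) = tdom C s"
| "tdom C (TTen t s) = tdom C t @ tdom C s"

primrec tcod :: "('o, 'a, 'e) smcat_scheme \<Rightarrow> ('o, 'a) lterm \<Rightarrow> 'o list" where
  "tcod C (TArr f) = [Cod C f]"
| "tcod C (TMult x z) = [TenO C x z]"
| "tcod C TUnit = [Unit C]"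
| "tcod C (TId xs) = xs"
| "tcod C (TComp t s) = tcod C t"
| "tcod C (TTen t s) = tcod C t @ tcod C s"

primrec twf :: "('o, 'a, 'e) smcat_scheme \<Rightarrow> ('o, 'a) lterm \<Rightarrow> bool" where
  "twf C (TArr f) \<longleftrightarrow> f \<in> Arr C"
| "twf C (TMult x z) \<longleftrightarrow> x \<in> Obj C \<and> z \<in> Obj C"
| "twf C TUnit \<longleftrightarrow> True"
| "twf C (TId xs) \<longleftrightarrow> xs \<in> lists (Obj C)"
| "twf C (TComp t s) \<longleftrightarrow> twf C t \<and> twf C s \<and> tcod C s = tdom C t"
| "twf C (TTen t s) \<longleftrightarrow> twf C t \<and> twf C s"

inductive teq :: "('o, 'a, 'e) smcat_scheme \<Rightarrow> ('o, 'a) lterm \<Rightarrow> ('o, 'a) lterm \<Rightarrow> bool"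
  for C where
  refl: "twf C t \<Longrightarrow> teq C t t"
| sym: "teq C t s \<Longrightarrow> teq C s t"
| trans: "\<lbrakk>teq C t s; teq C s r\<rbrakk> \<Longrightarrow> teq C t r"
| comp_cong: "\<lbrakk>teq C t t'; teq C s s'; tcod C s = tdom C t\<rbrakk>
    \<Longrightarrow> teq C (TComp t s) (TComp t' s')"
| ten_cong: "\<lbrakk>teq C t t'; teq C s s'\<rbrakk> \<Longrightarrow> teq C (TTen t s) (TTen t' s')"
  \<comment> \<open>axioms of a strict monoidal category\<close>
| comp_assoc: "\<lbrakk>twf C t; twf C s; twf C r; tcod C r = tdom C s; tcod C s = tdom C t\<rbrakk>
    \<Longrightarrow> teq C (TComp t (TComp s r)) (TComp (TComp t s) r)"
| comp_id: "twf C t \<Longrightarrow> teq C (TComp t (TId (tdom C t))) t"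
| id_comp: "twf C t \<Longrightarrow> teq C (TComp (TId (tcod C t)) t) t"
| ten_assoc: "\<lbrakk>twf C t; twf C s; twf C r\<rbrakk>
    \<Longrightarrow> teq C (TTen (TTen t s) r) (TTen t (TTen s r))"
| ten_unit_left: "twf C t \<Longrightarrow> teq C (TTen (TId []) t) t"
| ten_unit_right: "twf C t \<Longrightarrow> teq C (TTen t (TId [])) t"
| ten_id: "\<lbrakk>xs \<in> lists (Obj C); ys \<in> lists (Obj C)\<rbrakk>
    \<Longrightarrow> teq C (TTen (TId xs) (TId ys)) (TId (xs @ ys))"
| interchange: "\<lbrakk>twf C t; twf C s; twf C t'; twf C s';
      tcod C s = tdom C t; tcod C s' = tdom C t'\<rbrakk>
    \<Longrightarrow> teq C (TTen (TComp t s) (TComp t' s')) (TComp (TTen t t') (TTen s s'))"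
  \<comment> \<open>defining relations of \<open>L(C)\<close>\<close>
| rel0: "x \<in> Obj C \<Longrightarrow> teq C (TArr (Ident C x)) (TId [x])"
| rel1: "\<lbrakk>f \<in> Arr C; g \<in> Arr C; Cod C f = Dom C g\<rbrakk>
    \<Longrightarrow> teq C (TComp (TArr g) (TArr f)) (TArr (Comp C g f))"
| rel2: "\<lbrakk>f \<in> Hom C x y; f' \<in> Hom C x' y'\<rbrakk>
    \<Longrightarrow> teq C (TComp (TMult y y') (TTen (TArr f) (TArr f')))
              (TComp (TArr (TenA C f f')) (TMult x x'))"
| rel3: "\<lbrakk>x \<in> Obj C; z \<in> Obj C; w \<in> Obj C\<rbrakk>
    \<Longrightarrow> teq C (TComp (TMult (TenO C x z) w) (TTen (TMult x z) (TId [w])))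
              (TComp (TMult x (TenO C z w)) (TTen (TId [x]) (TMult z w)))"
| rel4: "x \<in> Obj C \<Longrightarrow> teq C (TComp (TMult x (Unit C)) (TTen (TId [x]) TUnit)) (TId [x])"
| rel5: "x \<in> Obj C \<Longrightarrow> teq C (TComp (TMult (Unit C) x) (TTen TUnit (TId [x]))) (TId [x])"

definition trel :: "('o, 'a, 'e) smcat_scheme \<Rightarrow> (('o, 'a) lterm \<times> ('o, 'a) lterm) set" where
  "trel C = {(t, s). teq C t s}"

definition tcls :: "('o, 'a, 'e) smcat_scheme \<Rightarrow> ('o, 'a) lterm \<Rightarrow> ('o, 'a) lterm set" where
  "tcls C t = trel C `` {t}"

text \<open>\<open>tdom\<close> and \<open>tcod\<close> are constant on each equivalence class (see \<open>teq_typing\<close> below), so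
  \<open>the_elem\<close> picks their common value.\<close>

definition L :: "('o, 'a, 'e) smcat_scheme \<Rightarrow> ('o list, ('o, 'a) lterm set) smcat" where
  "L C = \<lparr>
    Obj = lists (Obj C),
    Arr = {t. twf C t} // trel C,
    Dom = (\<lambda>A. the_elem (tdom C ` A)),
    Cod = (\<lambda>A. the_elem (tcod C ` A)),
    Ident = (\<lambda>xs. tcls C (TId xs)),
    Comp = (\<lambda>A B. \<Union>t\<in>A. \<Union>s\<in>B. tcls C (TComp t s)),
    Unit = [],
    TenO = (@),
    TenA = (\<lambda>A B. \<Union>t\<in>A. \<Union>s\<in>B. tcls C (TTen t s))\<rparr>"

section \<open>Functors and isomorphism of categories\<close>

record ('o, 'a, 'p, 'b) fun_data =
  FOb :: "'o \<Rightarrow> 'p"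
  FAr :: "'a \<Rightarrow> 'b"

locale cat_functor = A: category A + B: category B
  for A :: "('o, 'a, 'e) cat_scheme" and B :: "('p, 'b, 'd) cat_scheme" +
  fixes F :: "('o, 'a, 'p, 'b, 'f) fun_data_scheme"
  assumes FOb_Obj: "x \<in> Obj A \<Longrightarrow> FOb F x \<in> Obj B"
    and FAr_Hom: "f \<in> Hom A x y \<Longrightarrow> FAr F f \<in> Hom B (FOb F x) (FOb F y)"
    and FAr_Ident: "x \<in> Obj A \<Longrightarrow> FAr F (Ident A x) = Ident B (FOb F x)"
    and FAr_Comp: "\<lbrakk>f \<in> Hom A x y; g \<in> Hom A y z\<rbrakk>
      \<Longrightarrow> FAr F (Comp A g f) = Comp B (FAr F g) (FAr F f)"

definition isomorphic_categories ::
  "('o, 'a, 'e) cat_scheme \<Rightarrow> ('p, 'b, 'd) cat_scheme \<Rightarrow> bool" where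
  "isomorphic_categories A B \<longleftrightarrow>
    (\<exists>(F :: ('o, 'a, 'p, 'b) fun_data) (G :: ('p, 'b, 'o, 'a) fun_data).
      cat_functor A B F \<and> cat_functor B A G \<and>
      (\<forall>x\<in>Obj A. FOb G (FOb F x) = x) \<and> (\<forall>f\<in>Arr A. FAr G (FAr F f) = f) \<and>
      (\<forall>y\<in>Obj B. FOb F (FOb G y) = y) \<and> (\<forall>g\<in>Arr B. FAr F (FAr G g) = g))"

section \<open>Oplax and strict monoidal functors\<close>

record ('o, 'a, 'p, 'b) oplax_data = "('o, 'a, 'p, 'b) fun_data" +
  coh :: "'o \<Rightarrow> 'o \<Rightarrow> 'b"
  counit :: 'b

locale oplax_functor = C: strict_monoidal_category C + D: strict_monoidal_category D
    + cat_functor C D F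
  for C :: "('o, 'a, 'e) smcat_scheme" and D :: "('p, 'b, 'd) smcat_scheme"
    and F :: "('o, 'a, 'p, 'b, 'f) oplax_data_scheme" +
  assumes coh_Hom: "\<lbrakk>x \<in> Obj C; y \<in> Obj C\<rbrakk>
      \<Longrightarrow> coh F x y \<in> Hom D (FOb F (TenO C x y)) (TenO D (FOb F x) (FOb F y))"
    and counit_Hom: "counit F \<in> Hom D (FOb F (Unit C)) (Unit D)"
    and coh_natural: "\<lbrakk>f \<in> Hom C x y; f' \<in> Hom C x' y'\<rbrakk>
      \<Longrightarrow> Comp D (coh F y y') (FAr F (TenA C f f'))
        = Comp D (TenA D (FAr F f) (FAr F f')) (coh F x x')"
    and coh_assoc: "\<lbrakk>x \<in> Obj C; y \<in> Obj C; z \<in> Obj C\<rbrakk>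
      \<Longrightarrow> Comp D (TenA D (coh F x y) (Ident D (FOb F z))) (coh F (TenO C x y) z)
        = Comp D (TenA D (Ident D (FOb F x)) (coh F y z)) (coh F x (TenO C y z))"
    and counit_left: "x \<in> Obj C
      \<Longrightarrow> Comp D (TenA D (counit F) (Ident D (FOb F x))) (coh F (Unit C) x) = Ident D (FOb F x)"
    and counit_right: "x \<in> Obj C
      \<Longrightarrow> Comp D (TenA D (Ident D (FOb F x)) (counit F)) (coh F x (Unit C)) = Ident D (FOb F x)"

text \<open>Together with \<open>coh_Hom\<close> and \<open>counit_Hom\<close>, the conditions below force
  \<open>F (x \<otimes> y) = F x \<otimes> F y\<close> and \<open>F 1 = 1\<close>.\<close>

locale strict_functor = oplax_functor C D F
  for C :: "('o, 'a, 'e) smcat_scheme" and D :: "('p, 'b, 'd) smcat_scheme"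
    and F :: "('o, 'a, 'p, 'b, 'f) oplax_data_scheme" +
  assumes coh_identity: "\<lbrakk>x \<in> Obj C; y \<in> Obj C\<rbrakk>
      \<Longrightarrow> coh F x y = Ident D (TenO D (FOb F x) (FOb F y))"
    and counit_identity: "counit F = Ident D (Unit D)"

text \<open>A functor is a function on the carriers only.  Fixing the values outside the carriers makes
  HOL equality of functor data coincide with equality of functors.\<close>

definition ext_oplax_data ::
  "('o, 'a, 'e) smcat_scheme \<Rightarrow> ('o, 'a, 'p, 'b) oplax_data \<Rightarrow> bool" where
  "ext_oplax_data C F \<longleftrightarrow> FOb F \<in> extensional (Obj C) \<and> FAr F \<in> extensional (Arr C) \<and>
    (\<lambda>(x, y). coh F x y) \<in> extensional (Obj C \<times> Obj C)"

section \<open>Functor categories\<close>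

text \<open>A transformation records its source and target functors, so that distinct hom-sets are
  disjoint.\<close>

record ('o, 'a, 'p, 'b) transf =
  Src :: "('o, 'a, 'p, 'b) oplax_data"
  Tgt :: "('o, 'a, 'p, 'b) oplax_data"
  cpt :: "'o \<Rightarrow> 'b"

definition natural_transf ::
  "('o, 'a, 'e) smcat_scheme \<Rightarrow> ('p, 'b, 'd) smcat_scheme \<Rightarrow> ('o, 'a, 'p, 'b) transf \<Rightarrow> bool" where
  "natural_transf C D \<sigma> \<longleftrightarrow>
    cpt \<sigma> \<in> extensional (Obj C) \<and>
    (\<forall>x\<in>Obj C. cpt \<sigma> x \<in> Hom D (FOb (Src \<sigma>) x) (FOb (Tgt \<sigma>) x)) \<and>
    (\<forall>f\<in>Arr C. Comp D (cpt \<sigma> (Cod C f)) (FAr (Src \<sigma>) f)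
      = Comp D (FAr (Tgt \<sigma>) f) (cpt \<sigma> (Dom C f)))"

definition transf_category ::
  "('o, 'a, 'e) smcat_scheme \<Rightarrow> ('p, 'b, 'd) smcat_scheme \<Rightarrow> ('o, 'a, 'p, 'b) oplax_data set
    \<Rightarrow> (('o, 'a, 'p, 'b) transf \<Rightarrow> bool)
    \<Rightarrow> (('o, 'a, 'p, 'b) oplax_data, ('o, 'a, 'p, 'b) transf) cat" where
  "transf_category C D \<F> P = \<lparr>
    Obj = \<F>,
    Arr = {\<sigma>. Src \<sigma> \<in> \<F> \<and> Tgt \<sigma> \<in> \<F> \<and> natural_transf C D \<sigma> \<and> P \<sigma>},
    Dom = Src,
    Cod = Tgt,
    Ident = (\<lambda>F. \<lparr>Src = F, Tgt = F, cpt = (\<lambda>x\<in>Obj C. Ident D (FOb F x))\<rparr>),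
    Comp = (\<lambda>\<tau> \<sigma>. \<lparr>Src = Src \<sigma>, Tgt = Tgt \<tau>,
      cpt = (\<lambda>x\<in>Obj C. Comp D (cpt \<tau> x) (cpt \<sigma> x))\<rparr>)\<rparr>"

definition Oplax ::
  "('o, 'a, 'e) smcat_scheme \<Rightarrow> ('p, 'b, 'd) smcat_scheme
    \<Rightarrow> (('o, 'a, 'p, 'b) oplax_data, ('o, 'a, 'p, 'b) transf) cat" where
  "Oplax C D = transf_category C D {F. oplax_functor C D F \<and> ext_oplax_data C F}
    (\<lambda>\<sigma>. (\<forall>x\<in>Obj C. \<forall>y\<in>Obj C.
        Comp D (coh (Tgt \<sigma>) x y) (cpt \<sigma> (TenO C x y))
          = Comp D (TenA D (cpt \<sigma> x) (cpt \<sigma> y)) (coh (Src \<sigma>) x y)) \<and>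
      Comp D (counit (Tgt \<sigma>)) (cpt \<sigma> (Unit C)) = counit (Src \<sigma>))"

definition Strict ::
  "('o, 'a, 'e) smcat_scheme \<Rightarrow> ('p, 'b, 'd) smcat_scheme
    \<Rightarrow> (('o, 'a, 'p, 'b) oplax_data, ('o, 'a, 'p, 'b) transf) cat" where
  "Strict C D = transf_category C D {F. strict_functor C D F \<and> ext_oplax_data C F}
    (\<lambda>\<sigma>. (\<forall>x\<in>Obj C. \<forall>y\<in>Obj C. cpt \<sigma> (TenO C x y) = TenA D (cpt \<sigma> x) (cpt \<sigma> y)) \<and>
      cpt \<sigma> (Unit C) = Ident D (Unit D))"

section \<open>Well-definedness\<close>

lemma Hom_opp: "Hom (opp C) x y = Hom C y x"
  by (auto simp: Hom_def opp_def)

lemma category_opp: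
  assumes "category C"
  shows "category (opp C)"
proof -
  interpret category C by fact
  show ?thesis
  proof (unfold_locales, unfold Hom_opp)
  qed (auto simp: opp_def Dom_Obj Cod_Obj Ident_Hom Comp_Ident Ident_Comp Comp_assoc
      intro: Comp_Hom)
qed

lemma strict_monoidal_category_opp:
  fixes C :: "('o, 'a, 'e) smcat_scheme"
  assumes "strict_monoidal_category C"
  shows "strict_monoidal_category (opp C)"
proof -
  interpret strict_monoidal_category C by fact
  interpret op: category "opp C" by (rule category_opp) (rule category_axioms)
  show ?thesis
  proof (unfold_locales, unfold Hom_opp)
  qed (auto simp: opp_def Unit_Obj TenO_Obj TenO_assoc TenO_Unit_left TenO_Unit_right TenA_assoc
      TenA_Unit_left TenA_Unit_right TenA_Ident interchange intro: TenA_Hom)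
qed

context strict_monoidal_category
begin

lemma twf_lists: "twf C t \<Longrightarrow> tdom C t \<in> lists (Obj C) \<and> tcod C t \<in> lists (Obj C)"
  by (induction t) (auto simp: Dom_Obj Cod_Obj TenO_Obj Unit_Obj)

lemma teq_typing:
  "teq C t s \<Longrightarrow> twf C t \<and> twf C s \<and> tdom C t = tdom C s \<and> tcod C t = tcod C s"
proof (induction rule: teq.induct)
  case (rel0 x)
  then show ?case using Ident_Hom[of x] by (auto simp: Hom_def)
next
  case (rel1 f g)
  then show ?case using Comp_Hom[of f "Dom C f" "Dom C g" g "Cod C g"] by (auto simp: Hom_def)
next
  case (rel2 f x y f' x' y')
  then show ?case using TenA_Hom[of f x y f' x' y'] Dom_Obj Cod_Obj by (auto simp: Hom_def)
qed (use twf_lists in \<open>auto simp: TenO_Obj TenO_assoc TenO_Unit_left TenO_Unit_right Unit_Obj\<close>)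

lemma equiv_trel: "equiv {t. twf C t} (trel C)"
  by (rule equivI)
    (auto simp: trel_def refl_on_def sym_def trans_def dest: teq_typing intro: teq.refl teq.sym teq.trans)

lemma L_ArrE:
  assumes "A \<in> Arr (L C)"
  obtains t where "twf C t" "A = tcls C t"
  using assms by (auto simp: L_def tcls_def elim: quotientE)

lemma cls_nonempty: "twf C t \<Longrightarrow> tcls C t \<noteq> {}"
  by (auto simp: trel_def tcls_def intro: teq.refl)

lemma L_cls:
  assumes "twf C t"
  shows "tcls C t \<in> Arr (L C)" "Dom (L C) (tcls C t) = tdom C t"
    "Cod (L C) (tcls C t) = tcod C t"
proof -
  have t: "t \<in> tcls C t" using assms by (auto simp: trel_def tcls_def intro: teq.refl)
  have "tdom C ` (tcls C t) = {tdom C t}" "tcod C ` (tcls C t) = {tcod C t}"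
    using t by (auto simp: trel_def tcls_def dest: teq_typing)
  then show "Dom (L C) (tcls C t) = tdom C t" "Cod (L C) (tcls C t) = tcod C t"
    by (simp_all add: L_def)
  show "tcls C t \<in> Arr (L C)" using assms by (auto simp: L_def tcls_def intro: quotientI)
qed

lemma cls_eq_iff: "\<lbrakk>twf C t; twf C s\<rbrakk> \<Longrightarrow> tcls C t = tcls C s \<longleftrightarrow> teq C t s"
  using eq_equiv_class_iff[OF equiv_trel, of t s] by (auto simp: trel_def tcls_def)

lemma cls_eqI: "teq C t s \<Longrightarrow> tcls C t = tcls C s"
  using cls_eq_iff teq_typing by blast

lemma L_HomE:
  assumes "A \<in> Hom (L C) xs ys"
  obtains t where "twf C t" "tdom C t = xs" "tcod C t = ys" "A = tcls C t"
  using assms L_cls by (metis (mono_tags, lifting) Hom_def L_ArrE mem_Collect_eq)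

lemma L_HomI: "\<lbrakk>twf C t; tdom C t = xs; tcod C t = ys\<rbrakk> \<Longrightarrow> tcls C t \<in> Hom (L C) xs ys"
  using L_cls by (auto simp: Hom_def)

lemma L_Comp:
  assumes "twf C t" "twf C s" "tcod C s = tdom C t"
  shows "Comp (L C) (tcls C t) (tcls C s) = tcls C (TComp t s)"
proof -
  have same: "tcls C (TComp t' s') = tcls C (TComp t s)"
    if "t' \<in> tcls C t" "s' \<in> tcls C s" for t' s'
  proof -
    have "teq C t t'" "teq C s s'" using that by (auto simp: trel_def tcls_def)
    with assms teq_typing[of t t'] teq_typing[of s s'] show ?thesis
      by (subst cls_eq_iff) (auto intro: teq.comp_cong teq.sym)
  qed
  have "Comp (L C) (tcls C t) (tcls C s)
    = (\<Union>t'\<in>tcls C t. \<Union>s'\<in>tcls C s. tcls C (TComp t s))"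
    using same by (simp add: L_def del: UN_constant UN_simps cong: SUP_cong)
  also have "\<dots> = tcls C (TComp t s)"
    using cls_nonempty assms by simp
  finally show ?thesis .
qed

lemma L_Ten:
  assumes "twf C t" "twf C s"
  shows "TenA (L C) (tcls C t) (tcls C s) = tcls C (TTen t s)"
proof -
  have same: "tcls C (TTen t' s') = tcls C (TTen t s)"
    if "t' \<in> tcls C t" "s' \<in> tcls C s" for t' s'
  proof -
    have "teq C t t'" "teq C s s'" using that by (auto simp: trel_def tcls_def)
    with assms teq_typing[of t t'] teq_typing[of s s'] show ?thesis
      by (subst cls_eq_iff) (auto intro: teq.ten_cong teq.sym)
  qed
  have "TenA (L C) (tcls C t) (tcls C s)
    = (\<Union>t'\<in>tcls C t. \<Union>s'\<in>tcls C s. tcls C (TTen t s))"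
    using same by (simp add: L_def del: UN_constant UN_simps cong: SUP_cong)
  also have "\<dots> = tcls C (TTen t s)"
    using cls_nonempty assms by simp
  finally show ?thesis .
qed

lemma L_simps:
  "Obj (L C) = lists (Obj C)" "Ident (L C) xs = tcls C (TId xs)"
  "Unit (L C) = []" "TenO (L C) xs ys = xs @ ys"
  by (simp_all add: L_def)

lemma strict_monoidal_category_L: "strict_monoidal_category (L C)"
proof (unfold_locales, goal_cases)
  case (1 A)
  then show ?case by (metis L_ArrE L_cls(2) L_simps(1) twf_lists)
next
  case (2 A)
  then show ?case by (metis L_ArrE L_cls(3) L_simps(1) twf_lists)
next
  case (3 xs)
  then show ?case by (auto simp: L_simps intro!: L_HomI)
next
  case (4 A xs ys B zs)
  then show ?case by (auto simp: L_Comp elim!: L_HomE intro!: L_HomI)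
next
  case (5 A xs ys)
  then obtain t where t: "twf C t" "tdom C t = xs" "tcod C t = ys" "A = tcls C t"
    by (rule L_HomE)
  with twf_lists[of t] teq.comp_id[of C t] show ?case
    using L_Comp[of t "TId xs"] teq_typing by (simp add: L_simps cls_eq_iff)
next
  case (6 A xs ys)
  then obtain t where t: "twf C t" "tdom C t = xs" "tcod C t = ys" "A = tcls C t"
    by (rule L_HomE)
  with twf_lists[of t] teq.id_comp[of C t] show ?case
    using L_Comp[of "TId ys" t] teq_typing by (simp add: L_simps cls_eq_iff)
next
  case (7 f w x g y h z)
  then show ?case by (elim L_HomE) (simp add: L_Comp cls_eqI teq.comp_assoc)
next
  case (13 A xs ys B xs' ys')
  then show ?case by (auto simp: L_simps L_Ten elim!: L_HomE intro!: L_HomI)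
next
  case (14 A B D)
  then show ?case by (elim L_ArrE) (simp add: L_Ten cls_eqI teq.ten_assoc)
next
  case (15 A)
  then show ?case by (elim L_ArrE) (simp add: L_simps L_Ten cls_eqI teq.ten_unit_left)
next
  case (16 A)
  then show ?case by (elim L_ArrE) (simp add: L_simps L_Ten cls_eqI teq.ten_unit_right)
next
  case (17 xs ys)
  then show ?case by (simp add: L_simps L_Ten cls_eqI teq.ten_id del: in_lists_conv_set)
next
  case (18 f x y g z f' x' y' g' z')
  then show ?case by (elim L_HomE) (simp add: L_Comp L_Ten cls_eqI teq.interchange)
qed (auto simp: L_simps)

end

lemma category_transf_category:
  fixes C :: "('o, 'a, 'e) smcat_scheme" and D :: "('p, 'b, 'd) smcat_scheme"
    and \<F> :: "('o, 'a, 'p, 'b) oplax_data set"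
  assumes functors: "\<And>F. F \<in> \<F> \<Longrightarrow> cat_functor C D F"
    and P_Ident: "\<And>F. F \<in> \<F> \<Longrightarrow> P (Ident (transf_category C D \<F> P) F)"
    and P_Comp: "\<And>F G H \<sigma> \<tau>. \<lbrakk>\<sigma> \<in> Hom (transf_category C D \<F> P) F G;
      \<tau> \<in> Hom (transf_category C D \<F> P) G H\<rbrakk> \<Longrightarrow> P (Comp (transf_category C D \<F> P) \<tau> \<sigma>)"
  shows "category (transf_category C D \<F> P)"
proof (unfold_locales, goal_cases)
  case (3 F)
  then have F: "F \<in> \<F>" by (simp add: transf_category_def)
  then interpret cat_functor C D F by (rule functors)
  have "Comp D (Ident D (FOb F (Cod C f))) (FAr F f) = Comp D (FAr F f) (Ident D (FOb F (Dom C f)))"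
    if "f \<in> Arr C" for f
  proof -
    have "FAr F f \<in> Hom D (FOb F (Dom C f)) (FOb F (Cod C f))"
      using FAr_Hom[of f "Dom C f" "Cod C f"] that by (simp add: Hom_def)
    then show ?thesis by (simp add: B.Comp_Ident B.Ident_Comp)
  qed
  then have "natural_transf C D (Ident (transf_category C D \<F> P) F)"
    by (simp add: transf_category_def natural_transf_def A.Dom_Obj A.Cod_Obj B.Ident_Hom FOb_Obj)
  with P_Ident[OF F] F show ?case
    by (simp add: Hom_def) (simp add: transf_category_def)
next
  case (4 \<sigma> F G \<tau> H)
  then have mem: "F \<in> \<F>" "G \<in> \<F>" "H \<in> \<F>" and st: "Src \<sigma> = F" "Tgt \<sigma> = G" "Src \<tau> = G" "Tgt \<tau> = H"
    and nat: "natural_transf C D \<sigma>" "natural_transf C D \<tau>"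
    by (auto simp: transf_category_def Hom_def)
  interpret F: cat_functor C D F by (rule functors) fact
  interpret G: cat_functor C D G by (rule functors) fact
  interpret H: cat_functor C D H by (rule functors) fact
  have s: "cpt \<sigma> x \<in> Hom D (FOb F x) (FOb G x)" "cpt \<tau> x \<in> Hom D (FOb G x) (FOb H x)"
    if "x \<in> Obj C" for x
    using nat that by (auto simp: natural_transf_def st)
  have "Comp D (Comp D (cpt \<tau> (Cod C f)) (cpt \<sigma> (Cod C f))) (FAr F f)
      = Comp D (FAr H f) (Comp D (cpt \<tau> (Dom C f)) (cpt \<sigma> (Dom C f)))" if f: "f \<in> Arr C" for f
  proof -
    let ?x = "Dom C f" and ?y = "Cod C f"
    have o: "?x \<in> Obj C" "?y \<in> Obj C" using f F.A.Dom_Obj F.A.Cod_Obj by auto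
    have h: "f \<in> Hom C ?x ?y" using f by (simp add: Hom_def)
    have "Comp D (Comp D (cpt \<tau> ?y) (cpt \<sigma> ?y)) (FAr F f)
        = Comp D (cpt \<tau> ?y) (Comp D (cpt \<sigma> ?y) (FAr F f))"
      by (rule F.B.Comp_assoc[symmetric, OF F.FAr_Hom[OF h] s(1)[OF o(2)] s(2)[OF o(2)]])
    also have "Comp D (cpt \<sigma> ?y) (FAr F f) = Comp D (FAr G f) (cpt \<sigma> ?x)"
      using nat f by (simp add: natural_transf_def st)
    also have "Comp D (cpt \<tau> ?y) (Comp D (FAr G f) (cpt \<sigma> ?x))
        = Comp D (Comp D (cpt \<tau> ?y) (FAr G f)) (cpt \<sigma> ?x)"
      by (rule F.B.Comp_assoc[OF s(1)[OF o(1)] G.FAr_Hom[OF h] s(2)[OF o(2)]])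
    also have "Comp D (cpt \<tau> ?y) (FAr G f) = Comp D (FAr H f) (cpt \<tau> ?x)"
      using nat f by (simp add: natural_transf_def st)
    also have "Comp D (Comp D (FAr H f) (cpt \<tau> ?x)) (cpt \<sigma> ?x)
        = Comp D (FAr H f) (Comp D (cpt \<tau> ?x) (cpt \<sigma> ?x))"
      by (rule F.B.Comp_assoc[symmetric, OF s(1)[OF o(1)] s(2)[OF o(1)] H.FAr_Hom[OF h]])
    finally show ?thesis .
  qed
  then have "natural_transf C D (Comp (transf_category C D \<F> P) \<tau> \<sigma>)"
    using F.B.Comp_Hom[OF s] F.A.Dom_Obj F.A.Cod_Obj
    by (auto simp: natural_transf_def transf_category_def st)
  with P_Comp[OF 4] mem st show ?case
    by (simp add: Hom_def) (simp add: transf_category_def)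
next
  case (5 \<sigma> F G)
  then have mem: "F \<in> \<F>" and st: "Src \<sigma> = F" "Tgt \<sigma> = G" and nat: "natural_transf C D \<sigma>"
    by (auto simp: transf_category_def Hom_def)
  interpret cat_functor C D F by (rule functors) fact
  have "(\<lambda>x\<in>Obj C. Comp D (cpt \<sigma> x) (Ident D (FOb F x))) = cpt \<sigma>"
    using nat by (auto simp: natural_transf_def st fun_eq_iff extensional_def intro: B.Comp_Ident)
  with st show ?case
    by (simp add: transf_category_def cong: restrict_cong)
next
  case (6 \<sigma> F G)
  then have mem: "F \<in> \<F>" and st: "Src \<sigma> = F" "Tgt \<sigma> = G" and nat: "natural_transf C D \<sigma>"
    by (auto simp: transf_category_def Hom_def)
  interpret cat_functor C D F by (rule functors) fact
  have "(\<lambda>x\<in>Obj C. Comp D (Ident D (FOb G x)) (cpt \<sigma> x)) = cpt \<sigma>"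
    using nat by (auto simp: natural_transf_def st fun_eq_iff extensional_def intro: B.Ident_Comp)
  with st show ?case
    by (simp add: transf_category_def cong: restrict_cong)
next
  case (7 \<sigma> F G \<tau> H \<upsilon> K)
  then have mem: "F \<in> \<F>" and st: "Src \<sigma> = F" "Tgt \<sigma> = G" "Src \<tau> = G" "Tgt \<tau> = H"
      "Src \<upsilon> = H" "Tgt \<upsilon> = K"
    and nat: "natural_transf C D \<sigma>" "natural_transf C D \<tau>" "natural_transf C D \<upsilon>"
    by (auto simp: transf_category_def Hom_def)
  interpret cat_functor C D F by (rule functors) fact
  have "Comp D (cpt \<upsilon> x) (Comp D (cpt \<tau> x) (cpt \<sigma> x))
      = Comp D (Comp D (cpt \<upsilon> x) (cpt \<tau> x)) (cpt \<sigma> x)"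
    if "x \<in> Obj C" for x
    using nat that by (auto simp: natural_transf_def st intro: B.Comp_assoc)
  then show ?case
    by (simp add: transf_category_def st cong: restrict_cong)
qed (auto simp: transf_category_def)

lemma category_Oplax: "category (Oplax C D)"
  unfolding Oplax_def
proof (rule category_transf_category, goal_cases)
  case (1 F)
  then show ?case by (simp add: oplax_functor_def)
next
  case (2 F)
  then interpret oplax_functor C D F by simp
  have "Comp D (coh F x y) (Ident D (FOb F (TenO C x y)))
      = Comp D (TenA D (Ident D (FOb F x)) (Ident D (FOb F y))) (coh F x y)"
    if "x \<in> Obj C" "y \<in> Obj C" for x y
    using coh_Hom[OF that] that
    by (simp add: D.Comp_Ident D.Ident_Comp D.TenA_Ident FOb_Obj)
  then show ?case
    using D.Comp_Ident[OF counit_Hom] by (simp add: transf_category_def C.Unit_Obj C.TenO_Obj)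
next
  case (3 F G H \<sigma> \<tau>)
  then have F: "oplax_functor C D F" and G: "oplax_functor C D G" and H: "oplax_functor C D H"
    and st: "Src \<sigma> = F" "Tgt \<sigma> = G" "Src \<tau> = G" "Tgt \<tau> = H"
    and nat: "natural_transf C D \<sigma>" "natural_transf C D \<tau>"
    and mon: "\<And>x y. \<lbrakk>x \<in> Obj C; y \<in> Obj C\<rbrakk> \<Longrightarrow> Comp D (coh G x y) (cpt \<sigma> (TenO C x y))
        = Comp D (TenA D (cpt \<sigma> x) (cpt \<sigma> y)) (coh F x y)"
      "\<And>x y. \<lbrakk>x \<in> Obj C; y \<in> Obj C\<rbrakk> \<Longrightarrow> Comp D (coh H x y) (cpt \<tau> (TenO C x y))
        = Comp D (TenA D (cpt \<tau> x) (cpt \<tau> y)) (coh G x y)"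
      "Comp D (counit G) (cpt \<sigma> (Unit C)) = counit F"
      "Comp D (counit H) (cpt \<tau> (Unit C)) = counit G"
    by (auto simp: transf_category_def Hom_def)
  interpret F: oplax_functor C D F by fact
  interpret G: oplax_functor C D G by fact
  interpret H: oplax_functor C D H by fact
  have s: "cpt \<sigma> x \<in> Hom D (FOb F x) (FOb G x)" "cpt \<tau> x \<in> Hom D (FOb G x) (FOb H x)"
    if "x \<in> Obj C" for x
    using nat that by (auto simp: natural_transf_def st)
  have "Comp D (coh H x y) (Comp D (cpt \<tau> (TenO C x y)) (cpt \<sigma> (TenO C x y)))
      = Comp D (TenA D (Comp D (cpt \<tau> x) (cpt \<sigma> x)) (Comp D (cpt \<tau> y) (cpt \<sigma> y))) (coh F x y)"
    if o: "x \<in> Obj C" "y \<in> Obj C" for x y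
  proof -
    let ?xy = "TenO C x y"
    have xy: "?xy \<in> Obj C" using o by (rule F.C.TenO_Obj)
    note sT = F.D.TenA_Hom[OF s(1)[OF o(1)] s(1)[OF o(2)]]
    note tT = F.D.TenA_Hom[OF s(2)[OF o(1)] s(2)[OF o(2)]]
    have "Comp D (coh H x y) (Comp D (cpt \<tau> ?xy) (cpt \<sigma> ?xy))
        = Comp D (Comp D (coh H x y) (cpt \<tau> ?xy)) (cpt \<sigma> ?xy)"
      by (rule F.D.Comp_assoc[OF s(1)[OF xy] s(2)[OF xy] H.coh_Hom[OF o]])
    also have "\<dots> = Comp D (TenA D (cpt \<tau> x) (cpt \<tau> y)) (Comp D (coh G x y) (cpt \<sigma> ?xy))"
      unfolding mon(2)[OF o]
      by (rule F.D.Comp_assoc[symmetric, OF s(1)[OF xy] G.coh_Hom[OF o] tT])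
    also have "\<dots> = Comp D (Comp D (TenA D (cpt \<tau> x) (cpt \<tau> y)) (TenA D (cpt \<sigma> x) (cpt \<sigma> y)))
        (coh F x y)"
      unfolding mon(1)[OF o] by (rule F.D.Comp_assoc[OF F.coh_Hom[OF o] sT tT])
    also have "Comp D (TenA D (cpt \<tau> x) (cpt \<tau> y)) (TenA D (cpt \<sigma> x) (cpt \<sigma> y))
        = TenA D (Comp D (cpt \<tau> x) (cpt \<sigma> x)) (Comp D (cpt \<tau> y) (cpt \<sigma> y))"
      by (rule F.D.interchange[symmetric, OF s[OF o(1)] s[OF o(2)]])
    finally show ?thesis .
  qed
  moreover have "Comp D (counit H) (Comp D (cpt \<tau> (Unit C)) (cpt \<sigma> (Unit C))) = counit F"
    using F.D.Comp_assoc[OF s[OF F.C.Unit_Obj] H.counit_Hom] mon by simp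
  ultimately show ?case
    by (simp add: transf_category_def st F.C.Unit_Obj F.C.TenO_Obj)
qed

lemma category_Strict: "category (Strict C D)"
  unfolding Strict_def
proof (rule category_transf_category, goal_cases)
  case (1 F)
  then show ?case by (simp add: strict_functor_def oplax_functor_def)
next
  case (2 F)
  then interpret strict_functor C D F by simp
  have *: "FOb F (TenO C x y) = TenO D (FOb F x) (FOb F y)" if "x \<in> Obj C" "y \<in> Obj C" for x y
    using coh_Hom[OF that] D.Ident_Hom[of "TenO D (FOb F x) (FOb F y)"] that
    by (simp add: coh_identity D.TenO_Obj FOb_Obj Hom_def)
  have **: "FOb F (Unit C) = Unit D"
    using counit_Hom D.Ident_Hom[OF D.Unit_Obj] by (simp add: counit_identity Hom_def)
  show ?case
    by (simp add: transf_category_def C.Unit_Obj C.TenO_Obj * ** D.TenA_Ident FOb_Obj)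
next
  case (3 F G H \<sigma> \<tau>)
  then have F: "strict_functor C D F" and st: "Src \<sigma> = F" "Tgt \<sigma> = G" "Src \<tau> = G" "Tgt \<tau> = H"
    and nat: "natural_transf C D \<sigma>" "natural_transf C D \<tau>"
    and mon: "\<And>x y. \<lbrakk>x \<in> Obj C; y \<in> Obj C\<rbrakk> \<Longrightarrow> cpt \<sigma> (TenO C x y) = TenA D (cpt \<sigma> x) (cpt \<sigma> y)"
      "\<And>x y. \<lbrakk>x \<in> Obj C; y \<in> Obj C\<rbrakk> \<Longrightarrow> cpt \<tau> (TenO C x y) = TenA D (cpt \<tau> x) (cpt \<tau> y)"
      "cpt \<sigma> (Unit C) = Ident D (Unit D)" "cpt \<tau> (Unit C) = Ident D (Unit D)"
    by (auto simp: transf_category_def Hom_def)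
  interpret strict_functor C D F by fact
  have s: "cpt \<sigma> x \<in> Hom D (FOb F x) (FOb G x)" "cpt \<tau> x \<in> Hom D (FOb G x) (FOb H x)"
    if "x \<in> Obj C" for x
    using nat that by (auto simp: natural_transf_def st)
  have "Comp D (cpt \<tau> (TenO C x y)) (cpt \<sigma> (TenO C x y))
      = TenA D (Comp D (cpt \<tau> x) (cpt \<sigma> x)) (Comp D (cpt \<tau> y) (cpt \<sigma> y))"
    if o: "x \<in> Obj C" "y \<in> Obj C" for x y
    unfolding mon(1,2)[OF o] by (rule D.interchange[symmetric, OF s[OF o(1)] s[OF o(2)]])
  then show ?case
    using D.Comp_Ident[OF D.Ident_Hom[OF D.Unit_Obj]] mon
    by (simp add: transf_category_def C.Unit_Obj C.TenO_Obj)
qed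

end

theory Submission imports Defs begin

text \<open>Restricting a strict functor on \<open>L(C\<^sup>o\<^sup>p)\<^sup>o\<^sup>p\<close> to one-letter words and to the generators
  gives an oplax functor on \<open>C\<close>: the defining relations of \<open>L\<close>, read backwards, are exactly the
  oplax axioms.  Restriction is functorial, so it suffices that it is bijective on objects and on
  arrows.  It is injective because words and generators generate everything under tensor products
  and composition.  It is surjective because an oplax functor can be evaluated on formal terms,
  respecting all relations, and a transformation extends to words by tensoring its components;
  naturality of the extension need only be checked on generators.\<close>

section \<open>Isomorphisms of categories\<close>

text \<open>The inverse of a bijective functor is automatically a functor: injectivity on objects
  gives the preimage of an arrow the right endpoints, and injectivity on arrows makes the inverse
  preserve identities and composites. So functoriality is checked only in the direction that has an
  explicit formula.\<close>

lemma isomorphic_categoriesI: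
  fixes A :: "('o, 'a, 'e) cat_scheme" and B :: "('p, 'b, 'd) cat_scheme"
    and R :: "('p, 'b, 'o, 'a) fun_data"
  assumes R: "cat_functor B A R"
    and obj: "bij_betw (FOb R) (Obj B) (Obj A)"
    and arr: "bij_betw (FAr R) (Arr B) (Arr A)"
  shows "isomorphic_categories A B"
proof -
  interpret R: cat_functor B A R by fact
  define S :: "('o, 'a, 'p, 'b) fun_data"
    where "S = \<lparr>FOb = inv_into (Obj B) (FOb R), FAr = inv_into (Arr B) (FAr R)\<rparr>"
  have SO: "FOb S x \<in> Obj B" "FOb R (FOb S x) = x" if "x \<in> Obj A" for x
    using obj that bij_betw_inv_into_right[OF obj] bij_betwE[OF bij_betw_inv_into[OF obj]]
    by (auto simp: S_def)
  have SA: "FAr S f \<in> Arr B" "FAr R (FAr S f) = f" if "f \<in> Arr A" for f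
    using arr that bij_betw_inv_into_right[OF arr] bij_betwE[OF bij_betw_inv_into[OF arr]]
    by (auto simp: S_def)
  have OS: "FOb S (FOb R y) = y" if "y \<in> Obj B" for y
    using bij_betw_inv_into_left[OF obj that] by (simp add: S_def)
  have AS: "FAr S (FAr R g) = g" if "g \<in> Arr B" for g
    using bij_betw_inv_into_left[OF arr that] by (simp add: S_def)
  have SHom: "FAr S f \<in> Hom B (FOb S x) (FOb S y)" if f: "f \<in> Hom A x y" for f x y
  proof -
    have fA: "f \<in> Arr A" using f by (simp add: Hom_def)
    have g: "FAr S f \<in> Hom B (Dom B (FAr S f)) (Cod B (FAr S f))"
      using SA[OF fA] by (simp add: Hom_def)
    \<comment> \<open>\<open>R\<close> maps the endpoints of the preimage to \<open>x\<close> and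
      \<open>y\<close>, so \<open>OS\<close> recovers these endpoints as \<open>FOb S x\<close> and
      \<open>FOb S y\<close>.\<close>
    have "x = FOb R (Dom B (FAr S f))" "y = FOb R (Cod B (FAr S f))"
      using R.FAr_Hom[OF g] f SA[OF fA] by (auto simp: Hom_def)
    then show ?thesis
      using g OS R.A.Dom_Obj R.A.Cod_Obj SA(1)[OF fA] by simp
  qed
  have "cat_functor A B S"
  proof (unfold_locales, goal_cases)
    case (3 x)
    have "FAr S (Ident A x) = FAr S (FAr R (Ident B (FOb S x)))"
      using R.FAr_Ident SO[OF 3] by simp
    also have "\<dots> = Ident B (FOb S x)"
      using R.A.Ident_Hom[OF SO(1)[OF 3]] by (intro AS) (simp add: Hom_def)
    finally show ?case .
  next
    case (4 f x y g z)
    have fg: "FAr R (FAr S f) = f" "FAr R (FAr S g) = g" using 4 SA by (auto simp: Hom_def)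
    have "FAr S (Comp A g f) = FAr S (FAr R (Comp B (FAr S g) (FAr S f)))"
      by (subst R.FAr_Comp[OF SHom[OF 4(1)] SHom[OF 4(2)]]) (simp add: fg)
    also have "\<dots> = Comp B (FAr S g) (FAr S f)"
      using R.A.Comp_Hom[OF SHom[OF 4(1)] SHom[OF 4(2)]] by (intro AS) (simp add: Hom_def)
    finally show ?case .
  qed (use SO SHom in auto)
  with R SO SA OS AS show ?thesis
    unfolding isomorphic_categories_def by (intro exI[of _ S] exI[of _ R]) simp
qed

section \<open>Strict functors on the classifier\<close>

lemma opp_simps:
  "Obj (opp C) = Obj C" "Arr (opp C) = Arr C" "Dom (opp C) = Cod C" "Cod (opp C) = Dom C"
  "Ident (opp C) = Ident C" "Comp (opp C) g f = Comp C f g"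
  by (simp_all add: opp_def)

lemma opp_monoidal_simps:
  fixes C :: "('o, 'a, 'e) smcat_scheme"
  shows "Unit (opp C) = Unit C" "TenO (opp C) = TenO C" "TenA (opp C) = TenA C"
  by (simp_all add: opp_def)

lemma classifier_simps:
  "Obj (opp (L (opp C))) = lists (Obj C)" "Unit (opp (L (opp C))) = []"
  "TenO (opp (L (opp C))) = (@)" "Ident (opp (L (opp C))) xs = tcls (opp C) (TId xs)"
  "Arr (opp (L (opp C))) = Arr (L (opp C))"
  by (simp_all add: opp_def L_def)

section \<open>Strict functors preserve tensor products and the unit\<close>

context strict_functor
begin

lemma FOb_TenO:
  assumes "x \<in> Obj C" "y \<in> Obj C"
  shows "FOb F (TenO C x y) = TenO D (FOb F x) (FOb F y)"
  using coh_Hom[OF assms] D.Ident_Hom[of "TenO D (FOb F x) (FOb F y)"] assms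
  by (simp add: coh_identity D.TenO_Obj FOb_Obj Hom_def)

lemma FOb_Unit: "FOb F (Unit C) = Unit D"
  using counit_Hom D.Ident_Hom[OF D.Unit_Obj] by (simp add: counit_identity Hom_def)

text \<open>Both coherence morphisms in the naturality square are identities, so the square
  collapses to an equation between its two remaining sides.\<close>

lemma FAr_TenA:
  assumes f: "f \<in> Hom C x y" and g: "g \<in> Hom C x' y'"
  shows "FAr F (TenA C f g) = TenA D (FAr F f) (FAr F g)"
proof -
  have o: "x \<in> Obj C" "y \<in> Obj C" "x' \<in> Obj C" "y' \<in> Obj C"
    using f g C.Dom_Obj C.Cod_Obj by (auto simp: Hom_def)
  note h = FAr_Hom[OF C.TenA_Hom[OF f g]] D.TenA_Hom[OF FAr_Hom[OF f] FAr_Hom[OF g]]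
  show ?thesis
    using coh_natural[OF f g] h D.Ident_Comp[OF h(1)] D.Comp_Ident[OF h(2)]
    by (simp add: coh_identity o FOb_TenO)
qed

end

section \<open>Evaluation of a strict functor on formal terms\<close>

locale classifier_functor =
  base: strict_monoidal_category C + strict_functor "opp (L (opp C))" D G
  for C :: "('o, 'a, 'e) smcat_scheme" and D :: "('p, 'b, 'd) smcat_scheme"
    and G :: "('o list, ('o, 'a) lterm set, 'p, 'b) oplax_data"
begin

interpretation op: strict_monoidal_category "opp C"
  by (rule strict_monoidal_category_opp) (rule base.strict_monoidal_category_axioms)

abbreviation val :: "('o, 'a) lterm \<Rightarrow> 'b" where
  "val t \<equiv> FAr G (tcls (opp C) t)"

lemma FOb_Nil: "FOb G [] = Unit D"
  using FOb_Unit by (simp add: classifier_simps)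

lemma FOb_append:
  "\<lbrakk>xs \<in> lists (Obj C); ys \<in> lists (Obj C)\<rbrakk> \<Longrightarrow> FOb G (xs @ ys) = TenO D (FOb G xs) (FOb G ys)"
  using FOb_TenO[of xs ys] by (simp add: classifier_simps)

lemma FOb_lists: "xs \<in> lists (Obj C) \<Longrightarrow> FOb G xs \<in> Obj D"
  using FOb_Obj[of xs] by (simp add: classifier_simps)

lemma FOb_Cons:
  "\<lbrakk>x \<in> Obj C; xs \<in> lists (Obj C)\<rbrakk> \<Longrightarrow> FOb G (x # xs) = TenO D (FOb G [x]) (FOb G xs)"
  using FOb_append[of "[x]" xs] by simp

lemma FOb_pair:
  "\<lbrakk>x \<in> Obj C; y \<in> Obj C\<rbrakk> \<Longrightarrow> FOb G [x, y] = TenO D (FOb G [x]) (FOb G [y])"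
  using FOb_append[of "[x]" "[y]"] by simp

lemma typing_lists:
  "twf (opp C) t \<Longrightarrow> tdom (opp C) t \<in> lists (Obj C)"
  "twf (opp C) t \<Longrightarrow> tcod (opp C) t \<in> lists (Obj C)"
  using op.twf_lists[of t] by (simp_all add: opp_simps)

lemma cls_Hom:
  "twf (opp C) t \<Longrightarrow> tcls (opp C) t \<in> Hom (opp (L (opp C))) (tcod (opp C) t) (tdom (opp C) t)"
  by (simp add: Hom_opp op.L_HomI)

text \<open>The outer \<open>opp\<close> exchanges the domain and codomain of a term. On
  \<open>TArr f\<close> this undoes the exchange made by the inner \<open>opp\<close>, so
  \<open>val (TArr f)\<close> runs in the direction of \<open>f\<close>. On \<open>TMult\<close> and
  \<open>TUnit\<close>, which the inner \<open>opp\<close> leaves alone, it produces the directions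
  of an oplax structure.\<close>

lemma val_Hom:
  "twf (opp C) t \<Longrightarrow> val t \<in> Hom D (FOb G (tcod (opp C) t)) (FOb G (tdom (opp C) t))"
  by (rule FAr_Hom) (rule cls_Hom)

lemma val_eq: "teq (opp C) t s \<Longrightarrow> val t = val s"
  using op.cls_eqI by metis

lemma val_Id: "xs \<in> lists (Obj C) \<Longrightarrow> val (TId xs) = Ident D (FOb G xs)"
  using FAr_Ident[of xs] by (simp add: classifier_simps)

lemma val_Comp:
  assumes "twf (opp C) t" "twf (opp C) s" "tcod (opp C) s = tdom (opp C) t"
  shows "val (TComp t s) = Comp D (val s) (val t)"
  using FAr_Comp[OF cls_Hom[OF assms(1)], of "tcls (opp C) s" "tdom (opp C) s"]
    cls_Hom[OF assms(2)] assms
  by (simp add: opp_simps op.L_Comp)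

lemma val_Ten:
  assumes "twf (opp C) t" "twf (opp C) s"
  shows "val (TTen t s) = TenA D (val t) (val s)"
  using FAr_TenA[OF cls_Hom[OF assms(1)] cls_Hom[OF assms(2)]] assms
  by (simp add: opp_monoidal_simps op.L_Ten)

end

lemma (in strict_monoidal_category) classifier_functorI:
  "strict_functor (opp (L (opp C))) D G \<Longrightarrow> classifier_functor C D G"
  using strict_monoidal_category_axioms by (simp add: classifier_functor_def)

section \<open>Restriction to generators\<close>

text \<open>The values outside the carriers are fixed to \<open>undefined\<close>, as
  \<open>ext_oplax_data\<close> demands; only then can restriction be a bijection up to HOL
  equality. The conditional in \<open>coh\<close> plays the role of \<open>restrict\<close> for a
  curried function of two arguments.\<close>

definition gen_functor ::
  "('o, 'a, 'e) smcat_scheme \<Rightarrow> ('o list, ('o, 'a) lterm set, 'p, 'b) oplax_data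
    \<Rightarrow> ('o, 'a, 'p, 'b) oplax_data" where
  "gen_functor C G = \<lparr>
    FOb = (\<lambda>x\<in>Obj C. FOb G [x]),
    FAr = (\<lambda>f\<in>Arr C. FAr G (tcls (opp C) (TArr f))),
    coh = (\<lambda>x y. if x \<in> Obj C \<and> y \<in> Obj C then FAr G (tcls (opp C) (TMult x y)) else undefined),
    counit = FAr G (tcls (opp C) TUnit)\<rparr>"

definition gen_transf ::
  "('o, 'a, 'e) smcat_scheme \<Rightarrow> ('o list, ('o, 'a) lterm set, 'p, 'b) transf
    \<Rightarrow> ('o, 'a, 'p, 'b) transf" where
  "gen_transf C \<tau> = \<lparr>Src = gen_functor C (Src \<tau>), Tgt = gen_functor C (Tgt \<tau>),
    cpt = (\<lambda>x\<in>Obj C. cpt \<tau> [x])\<rparr>"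

lemma gen_functor_ext: "ext_oplax_data C (gen_functor C G)"
  by (auto simp: ext_oplax_data_def gen_functor_def extensional_def)

section \<open>The restriction of a strict functor is oplax\<close>

context classifier_functor
begin

lemma gen_functor_simps:
  "x \<in> Obj C \<Longrightarrow> FOb (gen_functor C G) x = FOb G [x]"
  "f \<in> Arr C \<Longrightarrow> FAr (gen_functor C G) f = val (TArr f)"
  "\<lbrakk>x \<in> Obj C; y \<in> Obj C\<rbrakk> \<Longrightarrow> coh (gen_functor C G) x y = val (TMult x y)"
  "counit (gen_functor C G) = val TUnit"
  by (simp_all add: gen_functor_def)

lemma gen_functor_cat_functor: "cat_functor C D (gen_functor C G)"
proof (unfold_locales, goal_cases)
  case (1 x)
  then show ?case using FOb_lists[of "[x]"] by (simp add: gen_functor_simps)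
next
  case (2 f x y)
  then show ?case using val_Hom[of "TArr f"] base.Dom_Obj base.Cod_Obj
    by (auto simp: gen_functor_simps opp_simps Hom_def)
next
  case (3 x)
  then have "Ident C x \<in> Arr C" using base.Ident_Hom by (auto simp: Hom_def)
  with 3 show ?case using val_eq[OF teq.rel0[of x "opp C"]] val_Id[of "[x]"]
    by (simp add: gen_functor_simps opp_simps)
next
  case (4 f x y g z)
  then have fg: "f \<in> Arr C" "g \<in> Arr C" "Cod C f = Dom C g" "Comp C g f \<in> Arr C"
    using base.Comp_Hom[OF 4] by (auto simp: Hom_def)
  then show ?case using val_eq[OF teq.rel1[of g "opp C" f]] val_Comp[of "TArr f" "TArr g"]
    by (simp add: gen_functor_simps opp_simps)
qed

text \<open>Each axiom is the image under \<open>G\<close> of one defining relation, with composites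
  reversed: \<open>rel2\<close> gives naturality, \<open>rel3\<close> coassociativity,
  \<open>rel5\<close> the left and \<open>rel4\<close> the right counit law.\<close>

lemma gen_functor_oplax: "oplax_functor C D (gen_functor C G)"
proof -
  interpret R: cat_functor C D "gen_functor C G" by (rule gen_functor_cat_functor)
  show ?thesis
  proof (unfold_locales, goal_cases)
    case (1 x y)
    then show ?case using val_Hom[of "TMult x y"]
      by (simp add: gen_functor_simps opp_simps opp_monoidal_simps FOb_pair base.TenO_Obj)
  next
    case 2
    show ?case using val_Hom[of TUnit]
      by (simp add: gen_functor_simps opp_monoidal_simps FOb_Nil base.Unit_Obj)
  next
    case (3 f x y f' x' y')
    then have ar: "f \<in> Arr C" "f' \<in> Arr C" "TenA C f f' \<in> Arr C"
        "Dom C (TenA C f f') = TenO C x x'" "Cod C (TenA C f f') = TenO C y y'"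
        "Dom C f = x" "Cod C f = y" "Dom C f' = x'" "Cod C f' = y'"
      using base.TenA_Hom[OF 3] by (auto simp: Hom_def)
    have o: "x \<in> Obj C" "y \<in> Obj C" "x' \<in> Obj C" "y' \<in> Obj C"
      using ar base.Dom_Obj base.Cod_Obj by auto
    \<comment> \<open>In \<open>opp C\<close> the arrow \<open>f\<close> runs from \<open>y\<close>
      to \<open>x\<close>, and \<open>f'\<close> from \<open>y'\<close> to \<open>x'\<close>; this
      is why the two multiplications appear in exchanged places.\<close>
    have "teq (opp C) (TComp (TMult x x') (TTen (TArr f) (TArr f')))
        (TComp (TArr (TenA C f f')) (TMult y y'))"
      using teq.rel2[of f "opp C" y x f' y' x'] 3 by (simp add: Hom_opp opp_monoidal_simps)
    from val_eq[OF this] show ?case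
      by (simp add: val_Comp val_Ten ar o gen_functor_simps opp_simps opp_monoidal_simps)
  next
    case (4 x y z)
    then show ?case
      using val_eq[OF teq.rel3[of x "opp C" y z]]
      by (simp add: val_Comp val_Ten val_Id gen_functor_simps opp_simps opp_monoidal_simps
          base.TenO_Obj)
  next
    case (5 x)
    then show ?case
      using val_eq[OF teq.rel5[of x "opp C"]]
      by (simp add: val_Comp val_Ten val_Id gen_functor_simps opp_simps opp_monoidal_simps
          base.Unit_Obj)
  next
    case (6 x)
    then show ?case
      using val_eq[OF teq.rel4[of x "opp C"]]
      by (simp add: val_Comp val_Ten val_Id gen_functor_simps opp_simps opp_monoidal_simps
          base.Unit_Obj)
  qed
qed

end

text \<open>Injectivity of restriction on objects. Every word is a tensor product of letters and
  every arrow is the class of a term built from generators, so agreement spreads by induction over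
  words and then over terms. The coherence data of a strict functor are forced to be
  identities.\<close>

lemma (in strict_monoidal_category) strict_functor_eqI:
  fixes D :: "('p, 'b, 'd) smcat_scheme"
    and G H :: "('o list, ('o, 'a) lterm set, 'p, 'b) oplax_data"
  assumes G: "strict_functor (opp (L (opp C))) D G" "ext_oplax_data (opp (L (opp C))) G"
    and H: "strict_functor (opp (L (opp C))) D H" "ext_oplax_data (opp (L (opp C))) H"
    and eq: "gen_functor C G = gen_functor C H"
  shows "G = H"
proof -
  interpret op: strict_monoidal_category "opp C"
    by (rule strict_monoidal_category_opp) (rule strict_monoidal_category_axioms)
  interpret G: classifier_functor C D G by (rule classifier_functorI) fact
  interpret H: classifier_functor C D H by (rule classifier_functorI) fact
  note simps = G.gen_functor_simps H.gen_functor_simps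
  have ob1: "FOb G [x] = FOb H [x]" if "x \<in> Obj C" for x
    using arg_cong[OF eq, of "\<lambda>K. FOb K x"] that by (simp add: simps)
  have ob: "FOb G xs = FOb H xs" if "xs \<in> lists (Obj C)" for xs
    using that
  proof (induction xs)
    case Nil
    show ?case by (simp add: G.FOb_Nil H.FOb_Nil)
  next
    case (Cons x xs)
    then show ?case by (simp add: G.FOb_Cons[of x xs] H.FOb_Cons[of x xs] ob1)
  qed
  have ar: "G.val t = H.val t" if "twf (opp C) t" for t
    using that
  proof (induction t)
    case (TArr f)
    then show ?case using arg_cong[OF eq, of "\<lambda>K. FAr K f"] by (simp add: simps opp_simps)
  next
    case (TMult x y)
    then show ?case using arg_cong[OF eq, of "\<lambda>K. coh K x y"] by (simp add: simps opp_simps)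
  next
    case TUnit
    show ?case using arg_cong[OF eq, of counit] by (simp add: simps)
  next
    case (TId xs)
    then show ?case by (simp add: G.val_Id H.val_Id ob opp_simps del: in_lists_conv_set)
  next
    case (TComp t s)
    then show ?case by (simp add: G.val_Comp H.val_Comp)
  next
    case (TTen t s)
    then show ?case by (simp add: G.val_Ten H.val_Ten)
  qed
  show ?thesis
  proof (rule oplax_data.equality)
    show "FOb G = FOb H"
    proof (rule extensionalityI)
      show "FOb G \<in> extensional (lists (Obj C))" "FOb H \<in> extensional (lists (Obj C))"
        using G(2) H(2) by (simp_all add: ext_oplax_data_def classifier_simps)
    qed (rule ob)
    show "FAr G = FAr H"
    proof (rule extensionalityI)
      show "FAr G \<in> extensional (Arr (L (opp C)))" "FAr H \<in> extensional (Arr (L (opp C)))"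
        using G(2) H(2) by (simp_all add: ext_oplax_data_def classifier_simps)
      show "FAr G A = FAr H A" if "A \<in> Arr (L (opp C))" for A
        using op.L_ArrE[OF that] ar by metis
    qed
    \<comment> \<open>Extensionality of \<open>coh\<close> is recorded for its uncurried form. On
      the carrier both sides are identities of the same object, by \<open>ob\<close>.\<close>
    have "(\<lambda>(x, y). coh G x y) = (\<lambda>(x, y). coh H x y)"
    proof (rule extensionalityI)
      let ?A = "lists (Obj C) \<times> lists (Obj C)"
      show "(\<lambda>(x, y). coh G x y) \<in> extensional ?A" "(\<lambda>(x, y). coh H x y) \<in> extensional ?A"
        using G(2) H(2) by (simp_all add: ext_oplax_data_def classifier_simps)
      show "(case p of (x, y) \<Rightarrow> coh G x y) = (case p of (x, y) \<Rightarrow> coh H x y)" if "p \<in> ?A" for p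
        using that ob G.coh_identity H.coh_identity
        by (cases p) (simp add: classifier_simps del: in_lists_conv_set)
    qed
    then show "coh G = coh H"
      by (auto simp: fun_eq_iff)
    show "counit G = counit H"
      by (simp add: G.counit_identity H.counit_identity)
  qed simp
qed

section \<open>Extension of oplax functors\<close>

context oplax_functor
begin

interpretation op: strict_monoidal_category "opp C"
  by (rule strict_monoidal_category_opp) (rule C.strict_monoidal_category_axioms)

text \<open>The recursion ends in the unit, so a one-letter word is sent to
  \<open>TenO D (FOb F x) (Unit D)\<close>. This equals \<open>FOb F x\<close> by the right unit
  law, which is why that law accompanies the treatment of generators below.\<close>

primrec ext_ob :: "'o list \<Rightarrow> 'p" where
  "ext_ob [] = Unit D"
| "ext_ob (x # xs) = TenO D (FOb F x) (ext_ob xs)"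

text \<open>Terms denote arrows of \<open>L (opp C)\<close>, while their values are to form a
  functor on its opposite; hence the reversed order in the \<open>TComp\<close> clause.\<close>

primrec ext_term :: "('o, 'a) lterm \<Rightarrow> 'b" where
  "ext_term (TArr f) = FAr F f"
| "ext_term (TMult x y) = coh F x y"
| "ext_term TUnit = counit F"
| "ext_term (TId xs) = Ident D (ext_ob xs)"
| "ext_term (TComp t s) = Comp D (ext_term s) (ext_term t)"
| "ext_term (TTen t s) = TenA D (ext_term t) (ext_term s)"

text \<open>\<open>ext_term\<close> is constant on equivalence classes by
  \<open>ext_term_eq\<close>, so \<open>the_elem\<close> selects its common value.\<close>

definition ext_functor :: "('o list, ('o, 'a) lterm set, 'p, 'b) oplax_data" where
  "ext_functor = \<lparr>
    FOb = restrict ext_ob (lists (Obj C)),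
    FAr = (\<lambda>A\<in>Arr (L (opp C)). the_elem (ext_term ` A)),
    coh = (\<lambda>xs ys. if xs \<in> lists (Obj C) \<and> ys \<in> lists (Obj C)
      then Ident D (TenO D (ext_ob xs) (ext_ob ys)) else undefined),
    counit = Ident D (Unit D)\<rparr>"

lemma ext_ob_Obj: "xs \<in> lists (Obj C) \<Longrightarrow> ext_ob xs \<in> Obj D"
  by (induction xs) (auto simp: D.Unit_Obj D.TenO_Obj FOb_Obj)

lemma ext_ob_append:
  "\<lbrakk>xs \<in> lists (Obj C); ys \<in> lists (Obj C)\<rbrakk> \<Longrightarrow> ext_ob (xs @ ys) = TenO D (ext_ob xs) (ext_ob ys)"
proof (induction xs)
  case Nil
  then show ?case using ext_ob_Obj[of ys] by (simp add: D.TenO_Unit_left)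
next
  case (Cons x xs)
  then show ?case using ext_ob_Obj[of ys] ext_ob_Obj[of xs] by (simp add: D.TenO_assoc FOb_Obj)
qed

lemma typing_lists:
  "twf (opp C) t \<Longrightarrow> tdom (opp C) t \<in> lists (Obj C)"
  "twf (opp C) t \<Longrightarrow> tcod (opp C) t \<in> lists (Obj C)"
  using op.twf_lists[of t] by (simp_all add: opp_simps)

lemma ext_term_Hom:
  "twf (opp C) t \<Longrightarrow> ext_term t \<in> Hom D (ext_ob (tcod (opp C) t)) (ext_ob (tdom (opp C) t))"
proof (induction t)
  case (TArr f)
  then show ?case using FAr_Hom[of f "Dom C f" "Cod C f"]
    by (simp add: Hom_def opp_simps D.TenO_Unit_right FOb_Obj C.Dom_Obj C.Cod_Obj)
next
  case (TMult x y)
  then show ?case using coh_Hom[of x y]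
    by (simp add: opp_simps opp_monoidal_simps D.TenO_Unit_right FOb_Obj C.TenO_Obj)
next
  case TUnit
  show ?case using counit_Hom by (simp add: opp_monoidal_simps D.TenO_Unit_right FOb_Obj C.Unit_Obj)
next
  case (TId xs)
  then show ?case by (simp add: D.Ident_Hom ext_ob_Obj opp_simps del: in_lists_conv_set)
next
  case (TComp t s)
  then show ?case by (auto intro: D.Comp_Hom)
next
  case (TTen t s)
  then show ?case by (simp add: ext_ob_append typing_lists D.TenA_Hom del: in_lists_conv_set)
qed

lemma ext_term_Arr: "twf (opp C) t \<Longrightarrow> ext_term t \<in> Arr D"
  using ext_term_Hom by (auto simp: Hom_def)

text \<open>Soundness of evaluation. The monoidal rules hold by the corresponding axioms of
  \<open>D\<close>, those for composition being read backwards, so that \<open>comp_id\<close>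
  becomes a left identity law. \<open>rel0\<close> and \<open>rel1\<close> are functoriality of
  \<open>F\<close>, and \<open>rel2\<close> to \<open>rel5\<close> are its oplax axioms.\<close>

lemma ext_term_eq: "teq (opp C) t s \<Longrightarrow> ext_term t = ext_term s"
proof (induction rule: teq.induct)
  case (comp_assoc t s r)
  then show ?case
    using D.Comp_assoc[OF ext_term_Hom[of t] _ ext_term_Hom[of r], of "ext_term s"] ext_term_Hom[of s]
    by simp
next
  case (comp_id t)
  then show ?case using D.Ident_Comp[OF ext_term_Hom[of t]] by simp
next
  case (id_comp t)
  then show ?case using D.Comp_Ident[OF ext_term_Hom[of t]] by simp
next
  case (ten_assoc t s r)
  then show ?case by (simp add: D.TenA_assoc ext_term_Arr)
next
  case (ten_unit_left t)
  then show ?case by (simp add: D.TenA_Unit_left ext_term_Arr)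
next
  case (ten_unit_right t)
  then show ?case by (simp add: D.TenA_Unit_right ext_term_Arr)
next
  case (ten_id xs ys)
  then show ?case
    by (simp add: opp_simps D.TenA_Ident ext_ob_Obj ext_ob_append del: in_lists_conv_set)
next
  case (interchange t s t' s')
  then show ?case
    using D.interchange[OF ext_term_Hom[of t] _ ext_term_Hom[of t'], of "ext_term s" _ "ext_term s'"]
      ext_term_Hom[of s] ext_term_Hom[of s']
    by simp
next
  case (rel0 x)
  then show ?case by (simp add: opp_simps FAr_Ident D.TenO_Unit_right FOb_Obj)
next
  case (rel1 f g)
  then show ?case using FAr_Comp[of g "Dom C g" "Cod C g" f "Cod C f"]
    by (simp add: opp_simps Hom_def)
next
  case (rel2 f x y f' x' y')
  then show ?case by (simp add: Hom_opp opp_monoidal_simps coh_natural)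
next
  case (rel3 x z w)
  then show ?case
    by (simp add: opp_simps opp_monoidal_simps D.TenO_Unit_right FOb_Obj coh_assoc)
next
  case (rel4 x)
  then show ?case
    by (simp add: opp_simps opp_monoidal_simps D.TenO_Unit_right FOb_Obj counit_right)
next
  case (rel5 x)
  then show ?case
    by (simp add: opp_simps opp_monoidal_simps D.TenO_Unit_right FOb_Obj counit_left)
qed simp_all

section \<open>The strict functor induced on equivalence classes\<close>

lemma ext_functor_cls:
  assumes "twf (opp C) t"
  shows "FAr ext_functor (tcls (opp C) t) = ext_term t"
proof -
  have "ext_term ` tcls (opp C) t = {ext_term t}"
    using ext_term_eq assms by (force simp: tcls_def trel_def intro: teq.refl)
  then show ?thesis
    using op.L_cls(1)[OF assms] by (simp add: ext_functor_def)
qed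

lemma ext_functor_FOb: "xs \<in> lists (Obj C) \<Longrightarrow> FOb ext_functor xs = ext_ob xs"
  by (simp add: ext_functor_def del: in_lists_conv_set)

lemma ext_functor_ext: "ext_oplax_data (opp (L (opp C))) ext_functor"
  by (auto simp: ext_oplax_data_def ext_functor_def classifier_simps extensional_def)

lemma ext_functor_cat_functor: "cat_functor (opp (L (opp C))) D ext_functor"
proof -
  interpret M: strict_monoidal_category "opp (L (opp C))"
    by (intro strict_monoidal_category_opp op.strict_monoidal_category_L)
  show ?thesis
  proof (unfold_locales, goal_cases)
    case (1 xs)
    then show ?case by (simp add: classifier_simps ext_functor_FOb ext_ob_Obj del: in_lists_conv_set)
  next
    case (2 A xs ys)
    then show ?case unfolding Hom_opp
      by (elim op.L_HomE) (use ext_term_Hom typing_lists ext_functor_FOb ext_functor_cls in auto)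
  next
    case (3 xs)
    then show ?case unfolding classifier_simps
      by (simp add: ext_functor_FOb ext_functor_cls opp_simps del: in_lists_conv_set)
  next
    case (4 A xs ys B zs)
    then show ?case unfolding Hom_opp
      by (elim op.L_HomE) (simp add: opp_simps op.L_Comp ext_functor_cls)
  qed
qed

lemma ext_functor_strict: "strict_functor (opp (L (opp C))) D ext_functor"
proof -
  interpret M: strict_monoidal_category "opp (L (opp C))"
    by (intro strict_monoidal_category_opp op.strict_monoidal_category_L)
  interpret E: cat_functor "opp (L (opp C))" D ext_functor
    by (rule ext_functor_cat_functor)
  have coh: "coh ext_functor xs ys = Ident D (ext_ob (xs @ ys))"
    if "xs \<in> lists (Obj C)" "ys \<in> lists (Obj C)" for xs ys
    using that by (simp add: ext_functor_def ext_ob_append)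
  have counit: "counit ext_functor = Ident D (Unit D)"
    by (simp add: ext_functor_def)
  show ?thesis
  proof (unfold_locales, goal_cases)
    case (1 xs ys)
    then show ?case
      using D.Ident_Hom[OF ext_ob_Obj[of "xs @ ys"]]
      by (simp add: classifier_simps coh ext_functor_FOb ext_ob_append)
  next
    case 2
    show ?case using D.Ident_Hom[OF D.Unit_Obj] by (simp add: classifier_simps counit ext_functor_FOb)
  next
    case (3 A xs ys B xs' ys')
    then obtain t s where t: "twf (opp C) t" "tdom (opp C) t = ys" "tcod (opp C) t = xs"
        "A = tcls (opp C) t"
      and s: "twf (opp C) s" "tdom (opp C) s = ys'" "tcod (opp C) s = xs'" "B = tcls (opp C) s"
      unfolding Hom_opp by (metis op.L_HomE)
    have l: "xs \<in> lists (Obj C)" "ys \<in> lists (Obj C)" "xs' \<in> lists (Obj C)" "ys' \<in> lists (Obj C)"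
      using t s typing_lists by blast+
    \<comment> \<open>Both sides of the naturality square are this arrow composed with an
      identity.\<close>
    have "ext_term (TTen t s) \<in> Hom D (ext_ob (xs @ xs')) (ext_ob (ys @ ys'))"
      using ext_term_Hom[of "TTen t s"] t s by simp
    from D.Ident_Comp[OF this] D.Comp_Ident[OF this] show ?case
      using t(1,4) s(1,4) l
      by (simp add: opp_monoidal_simps op.L_Ten ext_functor_cls coh del: in_lists_conv_set)
  next
    case (4 xs ys zs)
    then have l: "xs \<in> lists (Obj C)" "ys \<in> lists (Obj C)" "zs \<in> lists (Obj C)"
      by (simp_all add: classifier_simps del: in_lists_conv_set)
    note o = ext_ob_Obj[OF l(1)] ext_ob_Obj[OF l(2)] ext_ob_Obj[OF l(3)]
    show ?case
      using l o
      by (simp add: classifier_simps coh ext_functor_FOb ext_ob_append D.TenA_Ident D.TenO_Obj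
          D.TenO_assoc)
  next
    case (5 xs)
    then have l: "xs \<in> lists (Obj C)" by (simp add: classifier_simps del: in_lists_conv_set)
    show ?case
      using l ext_ob_Obj[OF l] D.Ident_Comp[OF D.Ident_Hom[OF ext_ob_Obj[OF l]]]
      by (simp add: classifier_simps coh counit ext_functor_FOb D.TenA_Ident D.Unit_Obj
          D.TenO_Unit_left)
  next
    case (6 xs)
    then have l: "xs \<in> lists (Obj C)" by (simp add: classifier_simps del: in_lists_conv_set)
    show ?case
      using l ext_ob_Obj[OF l] D.Ident_Comp[OF D.Ident_Hom[OF ext_ob_Obj[OF l]]]
      by (simp add: classifier_simps coh counit ext_functor_FOb D.TenA_Ident D.Unit_Obj
          D.TenO_Unit_right)
  next
    case (7 xs ys)
    then show ?case by (simp add: classifier_simps coh ext_functor_FOb ext_ob_append)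
  next
    case 8
    show ?case by (rule counit)
  qed
qed

end

text \<open>Evaluation returns the data of \<open>F\<close> on generators, and outside the carriers
  both sides are \<open>undefined\<close>. This provides the preimages under restriction of
  functors.\<close>

lemma gen_functor_ext_functor:
  fixes F :: "('o, 'a, 'p, 'b) oplax_data"
  assumes F: "oplax_functor C D F" "ext_oplax_data C F"
  shows "gen_functor C (oplax_functor.ext_functor C D F) = F"
proof -
  interpret oplax_functor C D F by fact
  show ?thesis
  proof (rule oplax_data.equality)
    show "FOb (gen_functor C ext_functor) = FOb F"
      using F(2)
      by (auto simp: gen_functor_def ext_oplax_data_def fun_eq_iff extensional_def
          ext_functor_FOb D.TenO_Unit_right FOb_Obj)
    show "FAr (gen_functor C ext_functor) = FAr F"
      using F(2)
      by (auto simp: gen_functor_def ext_oplax_data_def fun_eq_iff extensional_def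
          ext_functor_cls opp_simps)
    show "coh (gen_functor C ext_functor) = coh F"
      using F(2)
      by (auto simp: gen_functor_def ext_oplax_data_def fun_eq_iff extensional_def
          ext_functor_cls opp_simps)
  qed (simp_all add: gen_functor_def ext_functor_cls)
qed

section \<open>Transformations\<close>

lemma Oplax_simps:
  "Obj (Oplax C D) = {F. oplax_functor C D F \<and> ext_oplax_data C F}"
  "Dom (Oplax C D) = Src" "Cod (Oplax C D) = Tgt"
  "Ident (Oplax C D) F = \<lparr>Src = F, Tgt = F, cpt = (\<lambda>x\<in>Obj C. Ident D (FOb F x))\<rparr>"
  "Comp (Oplax C D) \<tau> \<sigma> = \<lparr>Src = Src \<sigma>, Tgt = Tgt \<tau>,
    cpt = (\<lambda>x\<in>Obj C. Comp D (cpt \<tau> x) (cpt \<sigma> x))\<rparr>"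
  by (simp_all add: Oplax_def transf_category_def)

lemma Strict_simps:
  "Obj (Strict C D) = {F. strict_functor C D F \<and> ext_oplax_data C F}"
  "Dom (Strict C D) = Src" "Cod (Strict C D) = Tgt"
  "Ident (Strict C D) F = \<lparr>Src = F, Tgt = F, cpt = (\<lambda>x\<in>Obj C. Ident D (FOb F x))\<rparr>"
  "Comp (Strict C D) \<tau> \<sigma> = \<lparr>Src = Src \<sigma>, Tgt = Tgt \<tau>,
    cpt = (\<lambda>x\<in>Obj C. Comp D (cpt \<tau> x) (cpt \<sigma> x))\<rparr>"
  by (simp_all add: Strict_def transf_category_def)

lemma Oplax_Arr_iff:
  "\<sigma> \<in> Arr (Oplax C D) \<longleftrightarrow>
    Src \<sigma> \<in> Obj (Oplax C D) \<and> Tgt \<sigma> \<in> Obj (Oplax C D) \<and>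
    cpt \<sigma> \<in> extensional (Obj C) \<and>
    (\<forall>x\<in>Obj C. cpt \<sigma> x \<in> Hom D (FOb (Src \<sigma>) x) (FOb (Tgt \<sigma>) x)) \<and>
    (\<forall>f\<in>Arr C. Comp D (cpt \<sigma> (Cod C f)) (FAr (Src \<sigma>) f)
      = Comp D (FAr (Tgt \<sigma>) f) (cpt \<sigma> (Dom C f))) \<and>
    (\<forall>x\<in>Obj C. \<forall>y\<in>Obj C. Comp D (coh (Tgt \<sigma>) x y) (cpt \<sigma> (TenO C x y))
      = Comp D (TenA D (cpt \<sigma> x) (cpt \<sigma> y)) (coh (Src \<sigma>) x y)) \<and>
    Comp D (counit (Tgt \<sigma>)) (cpt \<sigma> (Unit C)) = counit (Src \<sigma>)"
  by (auto simp: Oplax_def transf_category_def natural_transf_def)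

text \<open>Naturality is restated over well-formed terms instead of equivalence classes, which
  makes it accessible to instantiation at generators and to induction. Because of the outer
  \<open>opp\<close>, \<open>tdom\<close> stands where the codomain is expected.\<close>

lemma (in strict_monoidal_category) Strict_Arr_iff:
  fixes D :: "('p, 'b, 'd) smcat_scheme"
    and \<tau> :: "('o list, ('o, 'a) lterm set, 'p, 'b) transf"
  shows "\<tau> \<in> Arr (Strict (opp (L (opp C))) D) \<longleftrightarrow>
    Src \<tau> \<in> Obj (Strict (opp (L (opp C))) D) \<and> Tgt \<tau> \<in> Obj (Strict (opp (L (opp C))) D) \<and>
    cpt \<tau> \<in> extensional (lists (Obj C)) \<and>
    (\<forall>xs\<in>lists (Obj C). cpt \<tau> xs \<in> Hom D (FOb (Src \<tau>) xs) (FOb (Tgt \<tau>) xs)) \<and>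
    (\<forall>t. twf (opp C) t \<longrightarrow>
      Comp D (cpt \<tau> (tdom (opp C) t)) (FAr (Src \<tau>) (tcls (opp C) t))
        = Comp D (FAr (Tgt \<tau>) (tcls (opp C) t)) (cpt \<tau> (tcod (opp C) t))) \<and>
    (\<forall>xs\<in>lists (Obj C). \<forall>ys\<in>lists (Obj C). cpt \<tau> (xs @ ys) = TenA D (cpt \<tau> xs) (cpt \<tau> ys)) \<and>
    cpt \<tau> [] = Ident D (Unit D)"
proof -
  interpret op: strict_monoidal_category "opp C"
    by (rule strict_monoidal_category_opp) (rule strict_monoidal_category_axioms)
  \<comment> \<open>Every arrow is the class of a well-formed term, whose typing gives its
    endpoints. An arbitrary \<open>P\<close> allows the naturality equation to be substituted as a
    whole.\<close>
  have "(\<forall>A\<in>Arr (L (opp C)). P (Dom (L (opp C)) A) (Cod (L (opp C)) A) A) \<longleftrightarrow>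
      (\<forall>t. twf (opp C) t \<longrightarrow> P (tdom (opp C) t) (tcod (opp C) t) (tcls (opp C) t))" for P
    using op.L_ArrE op.L_cls by metis
  from this[of "\<lambda>xs ys A. Comp D (cpt \<tau> xs) (FAr (Src \<tau>) A) = Comp D (FAr (Tgt \<tau>) A) (cpt \<tau> ys)"]
  show ?thesis
    unfolding Strict_simps
    unfolding Strict_def transf_category_def natural_transf_def classifier_simps
    unfolding opp_simps by auto
qed

section \<open>Restriction of transformations and its inverse\<close>

context strict_monoidal_category
begin

lemma gen_functor_Oplax:
  "G \<in> Obj (Strict (opp (L (opp C))) D) \<Longrightarrow> gen_functor C G \<in> Obj (Oplax C D)"
  by (simp add: Strict_simps Oplax_simps gen_functor_ext classifier_functorI
      classifier_functor.gen_functor_oplax)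

text \<open>Naturality at the three kinds of generators yields the three conditions:
  \<open>TArr\<close> gives naturality over \<open>C\<close>, \<open>TMult\<close> compatibility
  with \<open>coh\<close>, and \<open>TUnit\<close> compatibility with
  \<open>counit\<close>.\<close>

lemma gen_transf_Oplax:
  fixes D :: "('p, 'b, 'd) smcat_scheme"
  assumes \<tau>: "\<tau> \<in> Arr (Strict (opp (L (opp C))) D)"
  shows "gen_transf C \<tau> \<in> Arr (Oplax C D)"
proof -
  note \<tau>' = \<tau>[unfolded Strict_Arr_iff]
  interpret G: classifier_functor C D "Src \<tau>"
    using \<tau>' by (intro classifier_functorI) (simp add: Strict_simps)
  interpret H: classifier_functor C D "Tgt \<tau>"
    using \<tau>' by (intro classifier_functorI) (simp add: Strict_simps)
  note simps = gen_transf_def opp_simps opp_monoidal_simps G.gen_functor_simps H.gen_functor_simps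
  have nat: "Comp D (cpt \<tau> (tdom (opp C) t)) (G.val t) = Comp D (H.val t) (cpt \<tau> (tcod (opp C) t))"
    if "twf (opp C) t" for t
    using \<tau>' that by blast
  have app: "cpt \<tau> [x, y] = TenA D (cpt \<tau> [x]) (cpt \<tau> [y])" if "x \<in> Obj C" "y \<in> Obj C" for x y
  proof -
    have "[x] \<in> lists (Obj C)" "[y] \<in> lists (Obj C)" using that by simp_all
    then have "cpt \<tau> ([x] @ [y]) = TenA D (cpt \<tau> [x]) (cpt \<tau> [y])" using \<tau>' by blast
    then show ?thesis by simp
  qed
  show ?thesis
    unfolding Oplax_Arr_iff
  proof (intro conjI ballI)
    show "Src (gen_transf C \<tau>) \<in> Obj (Oplax C D)" "Tgt (gen_transf C \<tau>) \<in> Obj (Oplax C D)"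
      using \<tau>' by (simp_all add: gen_transf_def gen_functor_Oplax)
    show "cpt (gen_transf C \<tau>) \<in> extensional (Obj C)"
      by (simp add: gen_transf_def)
  next
    fix x assume "x \<in> Obj C"
    then show "cpt (gen_transf C \<tau>) x
        \<in> Hom D (FOb (Src (gen_transf C \<tau>)) x) (FOb (Tgt (gen_transf C \<tau>)) x)"
      using \<tau>' by (simp add: simps)
  next
    fix f assume "f \<in> Arr C"
    then show "Comp D (cpt (gen_transf C \<tau>) (Cod C f)) (FAr (Src (gen_transf C \<tau>)) f)
        = Comp D (FAr (Tgt (gen_transf C \<tau>)) f) (cpt (gen_transf C \<tau>) (Dom C f))"
      using nat[of "TArr f"] by (simp add: simps Dom_Obj Cod_Obj)
  next
    fix x y assume "x \<in> Obj C" "y \<in> Obj C"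
    then show "Comp D (coh (Tgt (gen_transf C \<tau>)) x y) (cpt (gen_transf C \<tau>) (TenO C x y))
        = Comp D (TenA D (cpt (gen_transf C \<tau>) x) (cpt (gen_transf C \<tau>) y))
            (coh (Src (gen_transf C \<tau>)) x y)"
      using nat[of "TMult x y"] by (simp add: simps TenO_Obj app)
  next
    \<comment> \<open>The component at the empty word, the domain of \<open>TUnit\<close>, is an
      identity and disappears from the naturality equation.\<close>
    have "G.val TUnit \<in> Hom D (FOb (Src \<tau>) [Unit C]) (Unit D)"
      using G.val_Hom[of TUnit] by (simp add: simps G.FOb_Nil)
    from G.D.Ident_Comp[OF this]
    show "Comp D (counit (Tgt (gen_transf C \<tau>))) (cpt (gen_transf C \<tau>) (Unit C))
        = counit (Src (gen_transf C \<tau>))"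
      using nat[of TUnit] \<tau>' by (simp add: simps Unit_Obj)
  qed
qed

text \<open>The restricted transformation determines the restricted source and target, hence by
  \<open>strict_functor_eqI\<close> the source and target themselves. Monoidality determines the
  components on words from those on letters.\<close>

lemma Strict_transf_eqI:
  fixes D :: "('p, 'b, 'd) smcat_scheme"
  assumes \<sigma>: "\<sigma> \<in> Arr (Strict (opp (L (opp C))) D)" and \<tau>: "\<tau> \<in> Arr (Strict (opp (L (opp C))) D)"
    and eq: "gen_transf C \<sigma> = gen_transf C \<tau>"
  shows "\<sigma> = \<tau>"
proof (rule transf.equality)
  note \<sigma>' = \<sigma>[unfolded Strict_Arr_iff] and \<tau>' = \<tau>[unfolded Strict_Arr_iff]
  have *: "gen_functor C (Src \<sigma>) = gen_functor C (Src \<tau>)"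
    "gen_functor C (Tgt \<sigma>) = gen_functor C (Tgt \<tau>)"
    using eq by (simp_all add: gen_transf_def)
  show "Src \<sigma> = Src \<tau>"
    using \<sigma>' \<tau>' * by (intro strict_functor_eqI[where D = D]) (simp_all add: Strict_simps)
  show "Tgt \<sigma> = Tgt \<tau>"
    using \<sigma>' \<tau>' * by (intro strict_functor_eqI[where D = D]) (simp_all add: Strict_simps)
  have single: "cpt \<sigma> [x] = cpt \<tau> [x]" if "x \<in> Obj C" for x
    using arg_cong[OF eq, of "\<lambda>\<rho>. cpt \<rho> x"] that by (simp add: gen_transf_def)
  have app: "cpt \<sigma> (xs @ ys) = TenA D (cpt \<sigma> xs) (cpt \<sigma> ys)"
    "cpt \<tau> (xs @ ys) = TenA D (cpt \<tau> xs) (cpt \<tau> ys)"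
    if "xs \<in> lists (Obj C)" "ys \<in> lists (Obj C)" for xs ys
    using \<sigma>' \<tau>' that by (simp_all del: in_lists_conv_set)
  have "cpt \<sigma> xs = cpt \<tau> xs" if "xs \<in> lists (Obj C)" for xs
    using that
  proof (induction xs)
    case Nil
    show ?case using \<sigma>' \<tau>' by simp
  next
    case (Cons x xs)
    have "[x] \<in> lists (Obj C)" using Cons.hyps(1) by simp
    from app(1)[OF this Cons.hyps(2)] app(2)[OF this Cons.hyps(2)] show ?case
      by (simp add: Cons.IH single[OF Cons.hyps(1)])
  qed
  moreover have "cpt \<sigma> \<in> extensional (lists (Obj C))" "cpt \<tau> \<in> extensional (lists (Obj C))"
    using \<sigma>' \<tau>' by simp_all
  ultimately show "cpt \<sigma> = cpt \<tau>"
    by (intro extensionalityI)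
qed simp

text \<open>The components are extended to words by tensoring. Naturality follows by induction over
  terms: on generators it is what an arrow of \<open>Oplax C D\<close> satisfies, and it is closed
  under composition and tensor product. The lifts \<open>G\<close> and \<open>H\<close> of source
  and target may be arbitrary.\<close>

lemma gen_transf_surj:
  fixes D :: "('p, 'b, 'd) smcat_scheme"
    and G H :: "('o list, ('o, 'a) lterm set, 'p, 'b) oplax_data"
  assumes G: "G \<in> Obj (Strict (opp (L (opp C))) D)" and H: "H \<in> Obj (Strict (opp (L (opp C))) D)"
    and \<sigma>: "\<sigma> \<in> Arr (Oplax C D)" and src: "Src \<sigma> = gen_functor C G" and tgt: "Tgt \<sigma> = gen_functor C H"
  shows "\<exists>\<tau>\<in>Arr (Strict (opp (L (opp C))) D). gen_transf C \<tau> = \<sigma>"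
proof -
  interpret G: classifier_functor C D G
    using G by (intro classifier_functorI) (simp add: Strict_simps)
  interpret H: classifier_functor C D H
    using H by (intro classifier_functorI) (simp add: Strict_simps)
  note \<sigma>' = \<sigma>[unfolded Oplax_Arr_iff src tgt]
  note simps = opp_simps opp_monoidal_simps G.gen_functor_simps H.gen_functor_simps
  \<comment> \<open>Starting from the identity of the unit gives the value required at the empty
    word, and by the right unit law \<open>cpt \<sigma> x\<close> at \<open>[x]\<close>.\<close>
  define s where "s xs = foldr (\<lambda>x. TenA D (cpt \<sigma> x)) xs (Ident D (Unit D))" for xs
  have s_simps: "s [] = Ident D (Unit D)" "s (x # xs) = TenA D (cpt \<sigma> x) (s xs)" for x xs
    by (simp_all add: s_def)
  have \<sigma>_Hom: "cpt \<sigma> x \<in> Hom D (FOb G [x]) (FOb H [x])" if "x \<in> Obj C" for x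
    using \<sigma>' that by (simp add: simps)
  then have \<sigma>_Arr: "cpt \<sigma> x \<in> Arr D" if "x \<in> Obj C" for x
    using that by (simp add: Hom_def)
  have s_Hom: "s xs \<in> Hom D (FOb G xs) (FOb H xs)" if "xs \<in> lists (Obj C)" for xs
    using that
  proof (induction xs)
    case Nil
    show ?case by (simp add: s_simps G.FOb_Nil H.FOb_Nil G.D.Ident_Hom G.D.Unit_Obj)
  next
    case (Cons x xs)
    then show ?case
      using G.D.TenA_Hom[OF \<sigma>_Hom[of x] Cons.IH]
      by (simp add: s_simps G.FOb_Cons[of x xs] H.FOb_Cons[of x xs])
  qed
  then have s_Arr: "s xs \<in> Arr D" if "xs \<in> lists (Obj C)" for xs
    using that by (simp add: Hom_def)
  have s_append: "s (xs @ ys) = TenA D (s xs) (s ys)"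
    if "xs \<in> lists (Obj C)" "ys \<in> lists (Obj C)" for xs ys
    using that
  proof (induction xs)
    case Nil
    then show ?case using s_Arr[of ys] by (simp add: s_simps G.D.TenA_Unit_left)
  next
    case (Cons x xs)
    then show ?case using s_Arr[of xs] s_Arr[of ys] \<sigma>_Arr[of x] by (simp add: s_simps G.D.TenA_assoc)
  qed
  have s1: "s [x] = cpt \<sigma> x" if "x \<in> Obj C" for x
    using \<sigma>_Arr[OF that] by (simp add: s_simps G.D.TenA_Unit_right)
  have nat: "Comp D (s (tdom (opp C) t)) (G.val t) = Comp D (H.val t) (s (tcod (opp C) t))"
    if "twf (opp C) t" for t
    using that
  proof (induction t)
    case (TArr f)
    then show ?case using \<sigma>' by (simp add: simps s1 Dom_Obj Cod_Obj)
  next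
    case (TMult x y)
    then show ?case using \<sigma>' s_append[of "[x]" "[y]"] by (simp add: simps s1 TenO_Obj)
  next
    case TUnit
    have "G.val TUnit \<in> Hom D (FOb G [Unit C]) (Unit D)"
      using G.val_Hom[of TUnit] by (simp add: simps G.FOb_Nil)
    from G.D.Ident_Comp[OF this] show ?case using \<sigma>' by (simp add: simps s1 s_simps(1) Unit_Obj)
  next
    case (TId xs)
    then show ?case
      using G.D.Comp_Ident[OF s_Hom[of xs]] G.D.Ident_Comp[OF s_Hom[of xs]]
      by (simp add: G.val_Id H.val_Id simps del: in_lists_conv_set)
  next
    case (TComp t r)
    then have wf: "twf (opp C) t" "twf (opp C) r" and eq: "tcod (opp C) r = tdom (opp C) t"
      by simp_all
    note l = G.typing_lists[OF wf(1)] G.typing_lists[OF wf(2)]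
    note sh = l[THEN s_Hom] and Gh = wf[THEN G.val_Hom] and Hh = wf[THEN H.val_Hom]
    \<comment> \<open>Pasting of two naturality squares. Evaluation reverses composition, so in
      \<open>D\<close> the square of \<open>t\<close> precedes that of \<open>r\<close>.\<close>
    have "Comp D (s (tdom (opp C) r)) (Comp D (G.val r) (G.val t))
        = Comp D (Comp D (s (tdom (opp C) r)) (G.val r)) (G.val t)"
      using Gh sh by (intro G.D.Comp_assoc) (auto simp: eq)
    also have "\<dots> = Comp D (Comp D (H.val r) (s (tdom (opp C) t))) (G.val t)"
      using TComp.IH(2) wf eq by simp
    also have "\<dots> = Comp D (H.val r) (Comp D (s (tdom (opp C) t)) (G.val t))"
      using Gh Hh sh by (intro G.D.Comp_assoc[symmetric]) (auto simp: eq)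
    also have "\<dots> = Comp D (H.val r) (Comp D (H.val t) (s (tcod (opp C) t)))"
      using TComp.IH(1) wf by simp
    also have "\<dots> = Comp D (Comp D (H.val r) (H.val t)) (s (tcod (opp C) t))"
      using Hh sh by (intro G.D.Comp_assoc) (auto simp: eq)
    finally show ?case using wf eq by (simp add: G.val_Comp H.val_Comp)
  next
    case (TTen t r)
    then have wf: "twf (opp C) t" "twf (opp C) r"
      by simp_all
    note l = G.typing_lists[OF wf(1)] G.typing_lists[OF wf(2)]
    note sh = l[THEN s_Hom] and Gh = wf[THEN G.val_Hom] and Hh = wf[THEN H.val_Hom]
    \<comment> \<open>Interchange splits the square into the tensor product of the squares of
      \<open>t\<close> and \<open>r\<close>, and afterwards reassembles it.\<close>
    have "Comp D (TenA D (s (tdom (opp C) t)) (s (tdom (opp C) r))) (TenA D (G.val t) (G.val r))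
        = TenA D (Comp D (s (tdom (opp C) t)) (G.val t)) (Comp D (s (tdom (opp C) r)) (G.val r))"
      by (rule G.D.interchange[symmetric, OF Gh(1) sh(1) Gh(2) sh(3)])
    also have "\<dots> = TenA D (Comp D (H.val t) (s (tcod (opp C) t)))
        (Comp D (H.val r) (s (tcod (opp C) r)))"
      using TTen.IH wf by simp
    also have "\<dots> = Comp D (TenA D (H.val t) (H.val r))
        (TenA D (s (tcod (opp C) t)) (s (tcod (opp C) r)))"
      by (rule G.D.interchange[OF sh(2) Hh(1) sh(4) Hh(2)])
    finally show ?case
      using wf l by (simp add: G.val_Ten H.val_Ten s_append del: in_lists_conv_set)
  qed
  define \<tau> where "\<tau> = \<lparr>Src = G, Tgt = H, cpt = restrict s (lists (Obj C))\<rparr>"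
  have "\<tau> \<in> Arr (Strict (opp (L (opp C))) D)"
    unfolding Strict_Arr_iff using G H s_Hom nat s_append s_simps(1) G.typing_lists
    by (simp add: \<tau>_def del: in_lists_conv_set)
  moreover have "cpt (gen_transf C \<tau>) = cpt \<sigma>"
  proof (rule extensionalityI)
    show "cpt (gen_transf C \<tau>) \<in> extensional (Obj C)" "cpt \<sigma> \<in> extensional (Obj C)"
      using \<sigma>' by (simp_all add: gen_transf_def)
  qed (simp add: gen_transf_def \<tau>_def s1)
  then have "gen_transf C \<tau> = \<sigma>"
    using src tgt by (intro transf.equality) (simp_all add: gen_transf_def \<tau>_def)
  ultimately show ?thesis by blast
qed

end

section \<open>Bijectivity of restriction and the isomorphism of categories\<close>

lemma bij_betw_gen_functor:
  fixes C :: "('o, 'a, 'e) smcat_scheme" and D :: "('p, 'b, 'd) smcat_scheme"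
  assumes "strict_monoidal_category C"
  shows "bij_betw (gen_functor C) (Obj (Strict (opp (L (opp C))) D)) (Obj (Oplax C D))"
proof -
  interpret strict_monoidal_category C by fact
  show ?thesis
    unfolding bij_betw_def
  proof (intro conjI inj_onI subset_antisym image_subsetI subsetI)
    fix G H
    assume "G \<in> Obj (Strict (opp (L (opp C))) D)" "H \<in> Obj (Strict (opp (L (opp C))) D)"
      "gen_functor C G = gen_functor C H"
    then show "G = H" by (intro strict_functor_eqI[where D = D]) (simp_all add: Strict_simps)
  next
    fix F assume "F \<in> Obj (Oplax C D)"
    then have F: "oplax_functor C D F" "ext_oplax_data C F" by (simp_all add: Oplax_simps)
    interpret F: oplax_functor C D F by fact
    show "F \<in> gen_functor C ` Obj (Strict (opp (L (opp C))) D)"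
      using gen_functor_ext_functor[OF F] F.ext_functor_strict F.ext_functor_ext
      by (intro image_eqI[of _ _ F.ext_functor]) (simp_all add: Strict_simps)
  qed (rule gen_functor_Oplax)
qed

text \<open>Surjectivity here rests on surjectivity on objects: the source and target of a
  transformation must be lifted to strict functors before its components can be extended.\<close>

lemma bij_betw_gen_transf:
  fixes C :: "('o, 'a, 'e) smcat_scheme" and D :: "('p, 'b, 'd) smcat_scheme"
  assumes C: "strict_monoidal_category C"
  shows "bij_betw (gen_transf C) (Arr (Strict (opp (L (opp C))) D)) (Arr (Oplax C D))"
proof -
  interpret strict_monoidal_category C by fact
  show ?thesis
    unfolding bij_betw_def
  proof (intro conjI inj_onI subset_antisym image_subsetI subsetI)
    fix \<sigma> assume \<sigma>: "\<sigma> \<in> Arr (Oplax C D)"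
    then have "Src \<sigma> \<in> Obj (Oplax C D)" "Tgt \<sigma> \<in> Obj (Oplax C D)"
      by (simp_all add: Oplax_Arr_iff)
    then obtain G H where "G \<in> Obj (Strict (opp (L (opp C))) D)" "Src \<sigma> = gen_functor C G"
      "H \<in> Obj (Strict (opp (L (opp C))) D)" "Tgt \<sigma> = gen_functor C H"
      using bij_betw_imp_surj_on[OF bij_betw_gen_functor[OF C, of D]] by blast
    with gen_transf_surj[OF _ _ \<sigma>] show "\<sigma> \<in> gen_transf C ` Arr (Strict (opp (L (opp C))) D)"
      by blast
  qed (fact Strict_transf_eqI gen_transf_Oplax)+
qed

theorem proposition2p4:
  fixes C :: "('o, 'a) smcat" and D :: "('p, 'b) smcat"
  assumes "strict_monoidal_category C" and "strict_monoidal_category D"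
  shows "isomorphic_categories (Oplax C D) (Strict (opp (L (opp C))) D)"
proof (rule isomorphic_categoriesI)
  interpret C: strict_monoidal_category C by fact
  let ?M = "opp (L (opp C))"
  let ?R = "\<lparr>FOb = gen_functor C, FAr = gen_transf C\<rparr>
    :: (_, _, ('o, 'a, 'p, 'b) oplax_data, ('o, 'a, 'p, 'b) transf) fun_data"
  interpret S: category "Strict ?M D" by (rule category_Strict)
  interpret O: category "Oplax C D" by (rule category_Oplax)
  \<comment> \<open>Identities and composites are formed componentwise in both categories, so
    passing to one-letter words preserves them by computation.\<close>
  show "cat_functor (Strict ?M D) (Oplax C D) ?R"
  proof (unfold_locales, goal_cases)
    case (1 G)
    then show ?case by (simp add: C.gen_functor_Oplax)
  next
    case (2 \<tau> G H)
    then show ?case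
      using C.gen_transf_Oplax by (auto simp: Hom_def Strict_simps Oplax_simps gen_transf_def)
  next
    case (3 G)
    show ?case
      by (auto simp: gen_transf_def gen_functor_def Strict_simps Oplax_simps classifier_simps
          fun_eq_iff)
  next
    case (4 \<sigma> F G \<tau> H)
    show ?case
      by (auto simp: gen_transf_def Strict_simps Oplax_simps classifier_simps fun_eq_iff)
  qed
  show "bij_betw (FOb ?R) (Obj (Strict ?M D)) (Obj (Oplax C D))"
    using bij_betw_gen_functor[OF assms(1)] by simp
  show "bij_betw (FAr ?R) (Arr (Strict ?M D)) (Arr (Oplax C D))"
    using bij_betw_gen_transf[OF assms(1)] by simp
qed

end
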